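(* Let $A,f,\mathcal H,\mathcal Y,n,\mu_0,\psi_0,\psi_0^*$ satisfy the Basic Assumption stated in the context, and suppose that $f$ is homogeneous, i.e. there is $q\in\mathbb R$ such that $f(a\psi)=a^qf(\psi)$ for all $a>0$ and all $\psi\in\mathcal Y$. For $|\varepsilon|<\varepsilon_0$ let $(\mu(\varepsilon),\psi(\varepsilon))$ be the nonlinear eigenpair defined in the context. Then, for $|\varepsilon|<\varepsilon_0$, with $$\tilde\varepsilon=\varepsilon\|\psi(\varepsilon)\|^{q-1},$$ the pair $$(\tilde\mu(\tilde\varepsilon),\tilde\psi(\tilde\varepsilon))=\big(\mu(\varepsilon),\ \|\psi(\varepsilon)\|^{-1}\psi(\varepsilon)\big)$$ solves $(A-\tilde\mu)\tilde\psi-\tilde\varepsilon f(\tilde\psi)=0$ and satisfies $\|\tilde\psi(\tilde\varepsilon)\|=1$. Moreover, there is $\varepsilon_1\in(0,\varepsilon_0]$ such that the mapping $\varepsilon\mapsto\varepsilon\|\psi(\varepsilon)\|^{q-1}$ is injective on $\{|\varepsilon|<\varepsilon_1\}$.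
   Context: Basic Assumption. $A$ is a densely defined closed operator with non-empty resolvent set in a complex Hilbert space $(\mathcal H,\langle\cdot,\cdot\rangle)$ (inner product linear in the first argument) with induced norm $\|\cdot\|$; $f$ is a (generally nonlinear) mapping in $\mathcal H$; $(\mathcal Y,\|\cdot\|_{\mathcal Y})$ is a Banach space; and for $m\in\mathbb N_0$, $\|\phi\|_m:=\sum_{k=0}^m\|A^k\phi\|$ for $\phi\in\operatorname{Dom}(A^m)$ (with $A^0=I$). The following are assumed: (a) $\mathcal Y$ is a linear subspace of $\mathcal H$, for some $n\in\mathbb N$, $n\ge1$, one has $\operatorname{Dom}(A^n)\subset\mathcal Y\subset\operatorname{Dom}(A^{n-1})$, and there are $k_1,k_2>0$ such that $\|\phi\|_{n-1}\le k_1\|\phi\|_{\mathcal Y}\le k_2\|\phi\|_n$ for all $\phi\in\operatorname{Dom}(A^n)$. (b) $\mu_0\in\mathbb C$ is an isolated eigenvalue of $A$ that is simple, i.e. of algebraic multiplicity one; $\psi_0\in\operatorname{Dom}(A)$, $\psi_0^*\in\operatorname{Dom}(A^* )$ satisfy $A\psi_0=\mu_0\psi_0$, $A^*\psi_0^*=\overline{\mu_0}\psi_0^*$, $\|\psi_0\|=1$, $\langle\psi_0,\psi_0^*\rangle=1$. (c) $f:\mathcal Y\to\operatorname{Dom}(A^{n-1})$ and there exist $r_L>0$, $L>0$ such that $\|f(\phi)-f(\psi)\|_{n-1}\le k_1L\|\phi-\psi\|_{\mathcal Y}$ for all $\phi,\psi\in\{\eta\in\mathcal Y:\|\eta-\psi_0\|_{\mathcal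 Y}<r_L\}$. The nonlinear eigenpair. Let $P_0=\langle\cdot,\psi_0^*\rangle\psi_0$ (the spectral projection of $A$ for $\mu_0$), $Q_0=I-P_0$, $\nu=-\langle f(\psi_0),\psi_0^*\rangle$, and let $\phi$ be the unique solution in $Q_0\operatorname{Dom}(A)$ of $(A-\mu_0)\phi=\nu\psi_0+f(\psi_0)$. Let $C_{\mu_0}>0$ be a constant with $\|(Q_0(A-\mu_0)Q_0)^{-1}\eta\|_n\le C_{\mu_0}\|\eta\|_{n-1}$ for all $\eta\in Q_0\operatorname{Dom}(A^{n-1})$ (inverse taken in $Q_0\mathcal H$), and fix constants $r_1>k_1L\|P_0\|\|\phi\|_{\mathcal Y}$ and $r_2>k_2C_{\mu_0}(|\nu|+\|Q_0\|L)\|\phi\|_{\mathcal Y}$, $r_1,r_2>0$. There is $\varepsilon_0>0$ such that for every real $\varepsilon$ with $0<|\varepsilon|<\varepsilon_0$ the system $$0=\varepsilon\sigma+\langle f(\psi)-f(\psi_0),\psi_0^*\rangle,\qquad Q_0(A-\mu_0)Q_0\chi=\varepsilon[(\nu+\varepsilon\sigma)(\chi+\varepsilon\phi)+Q_0(f(\psi)-f(\psi_0))],$$ with $\psi=\psi_0+\varepsilon\phi+\chi$, has a unique solution $(\sigma,\chi)$, $\sigma\in\mathbb C$, $\chi\in Q_0\operatorname{Dom}(A)\cap\mathcal Y$, satisfying $|\sigma|\le r_1$, $\|\chi\|_{\mathcal Y}\le r_2\varepsilon^2$. Fix such an $\varepsilon_0$. The nonlinear eigenpair is $\mu(\varepsilon)=\mu_0+\varepsilon\nu+\varepsilon^2\sigma$,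 $\psi(\varepsilon)=\psi_0+\varepsilon\phi+\chi$ for this $(\sigma,\chi)$ when $0<|\varepsilon|<\varepsilon_0$, and $(\mu(0),\psi(0))=(\mu_0,\psi_0)$; it solves $(A-\mu)\psi-\varepsilon f(\psi)=0$, $\langle\psi,\psi_0^*\rangle=1$. *)

theory Defs
  imports "HOL-Analysis.Analysis"
begin

class complex_hilbert = banach +
  fixes scaleC :: "complex \<Rightarrow> 'a \<Rightarrow> 'a" (infixr \<open>*\<^sub>C\<close> 75)
    and cinner :: "'a \<Rightarrow> 'a \<Rightarrow> complex"
  assumes scaleC_add_right: "c *\<^sub>C (x + y) = c *\<^sub>C x + c *\<^sub>C y"
    and scaleC_add_left: "(c + d) *\<^sub>C x = c *\<^sub>C x + d *\<^sub>C x"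
    and scaleC_scaleC: "c *\<^sub>C d *\<^sub>C x = (c * d) *\<^sub>C x"
    and scaleC_one: "1 *\<^sub>C x = x"
    and scaleR_scaleC: "r *\<^sub>R x = complex_of_real r *\<^sub>C x"
    and cinner_add_left: "cinner (x + y) z = cinner x z + cinner y z"
    and cinner_scaleC_left: "cinner (c *\<^sub>C x) z = c * cinner x z"
    and cinner_commute: "cinner x y = cnj (cinner y x)"
    and cinner_self_nonneg: "cinner x x \<in> \<real> \<and> 0 \<le> Re (cinner x x)"
    and norm_eq_sqrt_cinner: "norm x = sqrt (Re (cinner x x))"

interpretation complex_vector: vector_space "scaleC :: complex \<Rightarrow> 'a \<Rightarrow> 'a::complex_hilbert"
  by unfold_locales (simp_all add: scaleC_add_right scaleC_add_left scaleC_scaleC scaleC_one)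

text \<open>An operator \<open>A\<close> in \<open>\<H>\<close> is a partial function; its domain is \<open>dom A\<close>. Outside
  the domain, \<open>A \<bullet>\<^sub>o x\<close> is unspecified.\<close>

abbreviation op_app :: "('a \<rightharpoonup> 'a) \<Rightarrow> 'a \<Rightarrow> 'a" (infixr \<open>\<bullet>\<^sub>o\<close> 75)
  where "A \<bullet>\<^sub>o x \<equiv> the (A x)"

definition linear_operator :: "('h::complex_hilbert \<rightharpoonup> 'h) \<Rightarrow> bool" where
  "linear_operator A \<longleftrightarrow>
     complex_vector.subspace (dom A) \<and>
     (\<forall>x\<in>dom A. \<forall>y\<in>dom A. A \<bullet>\<^sub>o (x + y) = A \<bullet>\<^sub>o x + A \<bullet>\<^sub>o y) \<and>
     (\<forall>c. \<forall>x\<in>dom A. A \<bullet>\<^sub>o (c *\<^sub>C x) = c *\<^sub>C (A \<bullet>\<^sub>o x))"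

definition densely_defined :: "('h::complex_hilbert \<rightharpoonup> 'h) \<Rightarrow> bool" where
  "densely_defined A \<longleftrightarrow> closure (dom A) = UNIV"

definition closed_operator :: "('h::complex_hilbert \<rightharpoonup> 'h) \<Rightarrow> bool" where
  "closed_operator A \<longleftrightarrow> closed {(x, y). A x = Some y}"

primrec op_pow :: "('h::complex_hilbert \<rightharpoonup> 'h) \<Rightarrow> nat \<Rightarrow> ('h \<rightharpoonup> 'h)" where
  "op_pow A 0 = Some"
| "op_pow A (Suc k) = A \<circ>\<^sub>m op_pow A k"

definition graph_norm :: "('h::complex_hilbert \<rightharpoonup> 'h) \<Rightarrow> nat \<Rightarrow> 'h \<Rightarrow> real" where
  "graph_norm A m x = (\<Sum>k\<le>m. norm (op_pow A k \<bullet>\<^sub>o x))"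

text \<open>If \<open>A\<close> is densely defined, the \<open>z\<close> below is unique.\<close>

definition adjoint_op :: "('h::complex_hilbert \<rightharpoonup> 'h) \<Rightarrow> ('h \<rightharpoonup> 'h)" where
  "adjoint_op A y =
     (if \<exists>z. \<forall>x\<in>dom A. cinner (A \<bullet>\<^sub>o x) y = cinner x z
      then Some (THE z. \<forall>x\<in>dom A. cinner (A \<bullet>\<^sub>o x) y = cinner x z)
      else None)"

definition resolvent :: "('h::complex_hilbert \<rightharpoonup> 'h) \<Rightarrow> complex \<Rightarrow> 'h \<Rightarrow> 'h" where
  "resolvent A z = inv_into (dom A) (\<lambda>x. A \<bullet>\<^sub>o x - z *\<^sub>C x)"

definition resolvent_set :: "('h::complex_hilbert \<rightharpoonup> 'h) \<Rightarrow> complex set" where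
  "resolvent_set A =
     {z. bij_betw (\<lambda>x. A \<bullet>\<^sub>o x - z *\<^sub>C x) (dom A) UNIV \<and> bounded_linear (resolvent A z)}"

definition spectrum :: "('h::complex_hilbert \<rightharpoonup> 'h) \<Rightarrow> complex set" where
  "spectrum A = - resolvent_set A"

definition eigenvalue :: "('h::complex_hilbert \<rightharpoonup> 'h) \<Rightarrow> complex \<Rightarrow> bool" where
  "eigenvalue A \<mu> \<longleftrightarrow> (\<exists>x\<in>dom A. x \<noteq> 0 \<and> A \<bullet>\<^sub>o x = \<mu> *\<^sub>C x)"

text \<open>The Riesz projection \<open>- 1/(2 \<pi> i) \<ointegral> (A - z)\<^sup>-\<^sup>1 dz\<close> over the circle of radius
  \<open>r\<close> about \<open>\<mu>\<close>, parametrised by \<open>z = \<mu> + r e\<^sup>i\<^sup>t\<close> (so \<open>dz = i r e\<^sup>i\<^sup>t dt\<close>).\<close>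

definition riesz_projection :: "('h::complex_hilbert \<rightharpoonup> 'h) \<Rightarrow> complex \<Rightarrow> real \<Rightarrow> 'h \<Rightarrow> 'h" where
  "riesz_projection A \<mu> r x =
     - (1 / (2 * pi)) *\<^sub>R
       integral {0..2*pi} (\<lambda>t. (of_real r * cis t) *\<^sub>C resolvent A (\<mu> + of_real r * cis t) x)"

text \<open>The algebraic multiplicity of an isolated point \<open>\<mu>\<close> of the spectrum is the dimension of the
  range of its Riesz projection, which is the same for all sufficiently small radii. Only
  \<open>m \<ge> 1\<close> is meaningful, as \<open>dim\<close> is 0 for infinite-dimensional spaces.\<close>

definition has_algebraic_multiplicity ::
  "('h::complex_hilbert \<rightharpoonup> 'h) \<Rightarrow> complex \<Rightarrow> nat \<Rightarrow> bool" where
  "has_algebraic_multiplicity A \<mu> m \<longleftrightarrow>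
     (\<forall>\<^sub>F r in at_right 0. complex_vector.dim (range (riesz_projection A \<mu> r)) = m)"

definition isolated_simple_eigenvalue :: "('h::complex_hilbert \<rightharpoonup> 'h) \<Rightarrow> complex \<Rightarrow> bool" where
  "isolated_simple_eigenvalue A \<mu> \<longleftrightarrow>
     eigenvalue A \<mu> \<and> \<mu> isolated_in spectrum A \<and> has_algebraic_multiplicity A \<mu> 1"

definition banach_subspace :: "'h::complex_hilbert set \<Rightarrow> ('h \<Rightarrow> real) \<Rightarrow> bool" where
  "banach_subspace Y N \<longleftrightarrow>
     complex_vector.subspace Y \<and>
     (\<forall>x\<in>Y. 0 \<le> N x \<and> (N x = 0 \<longleftrightarrow> x = 0)) \<and>
     (\<forall>x\<in>Y. \<forall>y\<in>Y. N (x + y) \<le> N x + N y) \<and>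
     (\<forall>c. \<forall>x\<in>Y. N (c *\<^sub>C x) = cmod c * N x) \<and>
     (\<forall>s::nat \<Rightarrow> 'h. range s \<subseteq> Y \<and> (\<forall>e>0. \<exists>M. \<forall>i\<ge>M. \<forall>j\<ge>M. N (s i - s j) < e)
        \<longrightarrow> (\<exists>l\<in>Y. (\<lambda>i. N (s i - l)) \<longlonglongrightarrow> 0))"

locale basic_assumption =
  fixes A :: "'h::complex_hilbert \<rightharpoonup> 'h"
    and f :: "'h \<Rightarrow> 'h"
    and Y :: "'h set"
    and normY :: "'h \<Rightarrow> real"
    and n :: nat
    and \<mu>0 :: complex
    and \<psi>0 \<psi>0s :: 'h
    and k1 k2 rL L :: real
  assumes linear_A: "linear_operator A"
    and dense_A: "densely_defined A"
    and closed_A: "closed_operator A"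
    and resolvent_A: "resolvent_set A \<noteq> {}"
    and banach_Y: "banach_subspace Y normY"
    and n_ge_1: "n \<ge> 1"
    and Y_lower: "dom (op_pow A n) \<subseteq> Y"
    and Y_upper: "Y \<subseteq> dom (op_pow A (n - 1))"
    and k1_pos: "k1 > 0"
    and k2_pos: "k2 > 0"
    and norm_lower: "\<And>x. x \<in> dom (op_pow A n) \<Longrightarrow> graph_norm A (n - 1) x \<le> k1 * normY x"
    and norm_upper: "\<And>x. x \<in> dom (op_pow A n) \<Longrightarrow> k1 * normY x \<le> k2 * graph_norm A n x"
    and simple_\<mu>0: "isolated_simple_eigenvalue A \<mu>0"
    and \<psi>0_dom: "\<psi>0 \<in> dom A"
    and \<psi>0s_dom: "\<psi>0s \<in> dom (adjoint_op A)"
    and \<psi>0_eigen: "A \<bullet>\<^sub>o \<psi>0 = \<mu>0 *\<^sub>C \<psi>0"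
    and \<psi>0s_eigen: "adjoint_op A \<bullet>\<^sub>o \<psi>0s = cnj \<mu>0 *\<^sub>C \<psi>0s"
    and \<psi>0_norm: "norm \<psi>0 = 1"
    and \<psi>0_\<psi>0s: "cinner \<psi>0 \<psi>0s = 1"
    and f_range: "f ` Y \<subseteq> dom (op_pow A (n - 1))"
    and rL_pos: "rL > 0"
    and L_pos: "L > 0"
    and f_lipschitz: "\<And>x y. \<lbrakk>x \<in> Y; y \<in> Y; normY (x - \<psi>0) < rL; normY (y - \<psi>0) < rL\<rbrakk>
          \<Longrightarrow> graph_norm A (n - 1) (f x - f y) \<le> k1 * L * normY (x - y)"

definition P0 :: "'h::complex_hilbert \<Rightarrow> 'h \<Rightarrow> 'h \<Rightarrow> 'h" where
  "P0 \<psi>0 \<psi>0s x = cinner x \<psi>0s *\<^sub>C \<psi>0"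

definition Q0 :: "'h::complex_hilbert \<Rightarrow> 'h \<Rightarrow> 'h \<Rightarrow> 'h" where
  "Q0 \<psi>0 \<psi>0s x = x - P0 \<psi>0 \<psi>0s x"

definition nu :: "('h::complex_hilbert \<Rightarrow> 'h) \<Rightarrow> 'h \<Rightarrow> 'h \<Rightarrow> complex" where
  "nu f \<psi>0 \<psi>0s = - cinner (f \<psi>0) \<psi>0s"

text \<open>\<open>Q\<^sub>0(A - \<mu>\<^sub>0)Q\<^sub>0\<close>, as an operator in \<open>Q\<^sub>0\<H>\<close> with domain \<open>Q\<^sub>0 Dom(A)\<close>.\<close>

definition reduced_op ::
  "('h::complex_hilbert \<rightharpoonup> 'h) \<Rightarrow> complex \<Rightarrow> 'h \<Rightarrow> 'h \<Rightarrow> 'h \<Rightarrow> 'h" where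
  "reduced_op A \<mu>0 \<psi>0 \<psi>0s x =
     Q0 \<psi>0 \<psi>0s (A \<bullet>\<^sub>o Q0 \<psi>0 \<psi>0s x - \<mu>0 *\<^sub>C Q0 \<psi>0 \<psi>0s x)"

definition reduced_inverse ::
  "('h::complex_hilbert \<rightharpoonup> 'h) \<Rightarrow> complex \<Rightarrow> 'h \<Rightarrow> 'h \<Rightarrow> 'h \<Rightarrow> 'h" where
  "reduced_inverse A \<mu>0 \<psi>0 \<psi>0s = inv_into (Q0 \<psi>0 \<psi>0s ` dom A) (reduced_op A \<mu>0 \<psi>0 \<psi>0s)"

definition is_correction ::
  "('h::complex_hilbert \<rightharpoonup> 'h) \<Rightarrow> ('h \<Rightarrow> 'h) \<Rightarrow> 'h set \<Rightarrow> ('h \<Rightarrow> real) \<Rightarrow> complex \<Rightarrow> 'h \<Rightarrow> 'h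
    \<Rightarrow> 'h \<Rightarrow> real \<Rightarrow> real \<Rightarrow> real \<Rightarrow> complex \<times> 'h \<Rightarrow> bool" where
  "is_correction A f Y normY \<mu>0 \<psi>0 \<psi>0s \<phi> r1 r2 \<epsilon> = (\<lambda>(\<sigma>, chi).
     chi \<in> Q0 \<psi>0 \<psi>0s ` dom A \<inter> Y \<and> cmod \<sigma> \<le> r1 \<and> normY chi \<le> r2 * \<epsilon>\<^sup>2 \<and>
     (let \<psi> = \<psi>0 + \<epsilon> *\<^sub>R \<phi> + chi; \<nu> = nu f \<psi>0 \<psi>0s in
        0 = of_real \<epsilon> * \<sigma> + cinner (f \<psi> - f \<psi>0) \<psi>0s \<and>
        reduced_op A \<mu>0 \<psi>0 \<psi>0s chi =
          \<epsilon> *\<^sub>R ((\<nu> + of_real \<epsilon> * \<sigma>) *\<^sub>C (chi + \<epsilon> *\<^sub>R \<phi>) + Q0 \<psi>0 \<psi>0s (f \<psi> - f \<psi>0))))"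

definition correction ::
  "('h::complex_hilbert \<rightharpoonup> 'h) \<Rightarrow> ('h \<Rightarrow> 'h) \<Rightarrow> 'h set \<Rightarrow> ('h \<Rightarrow> real) \<Rightarrow> complex \<Rightarrow> 'h \<Rightarrow> 'h
    \<Rightarrow> 'h \<Rightarrow> real \<Rightarrow> real \<Rightarrow> real \<Rightarrow> complex \<times> 'h" where
  "correction A f Y normY \<mu>0 \<psi>0 \<psi>0s \<phi> r1 r2 \<epsilon> =
     (THE p. is_correction A f Y normY \<mu>0 \<psi>0 \<psi>0s \<phi> r1 r2 \<epsilon> p)"

definition nonlinear_eigenvalue ::
  "('h::complex_hilbert \<rightharpoonup> 'h) \<Rightarrow> ('h \<Rightarrow> 'h) \<Rightarrow> 'h set \<Rightarrow> ('h \<Rightarrow> real) \<Rightarrow> complex \<Rightarrow> 'h \<Rightarrow> 'h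
    \<Rightarrow> 'h \<Rightarrow> real \<Rightarrow> real \<Rightarrow> real \<Rightarrow> complex" where
  "nonlinear_eigenvalue A f Y normY \<mu>0 \<psi>0 \<psi>0s \<phi> r1 r2 \<epsilon> =
     (if \<epsilon> = 0 then \<mu>0
      else \<mu>0 + of_real \<epsilon> * nu f \<psi>0 \<psi>0s
             + of_real (\<epsilon>\<^sup>2) * fst (correction A f Y normY \<mu>0 \<psi>0 \<psi>0s \<phi> r1 r2 \<epsilon>))"

definition nonlinear_eigenvector ::
  "('h::complex_hilbert \<rightharpoonup> 'h) \<Rightarrow> ('h \<Rightarrow> 'h) \<Rightarrow> 'h set \<Rightarrow> ('h \<Rightarrow> real) \<Rightarrow> complex \<Rightarrow> 'h \<Rightarrow> 'h
    \<Rightarrow> 'h \<Rightarrow> real \<Rightarrow> real \<Rightarrow> real \<Rightarrow> 'h" where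
  "nonlinear_eigenvector A f Y normY \<mu>0 \<psi>0 \<psi>0s \<phi> r1 r2 \<epsilon> =
     (if \<epsilon> = 0 then \<psi>0
      else \<psi>0 + \<epsilon> *\<^sub>R \<phi> + snd (correction A f Y normY \<mu>0 \<psi>0 \<psi>0s \<phi> r1 r2 \<epsilon>))"

text \<open>\<open>(A - \<mu>)\<psi> - \<epsilon> f(\<psi>) = 0\<close>, including that both terms are defined.\<close>

definition solves_nonlinear_eigenproblem ::
  "('h::complex_hilbert \<rightharpoonup> 'h) \<Rightarrow> ('h \<Rightarrow> 'h) \<Rightarrow> 'h set \<Rightarrow> real \<Rightarrow> complex \<Rightarrow> 'h \<Rightarrow> bool" where
  "solves_nonlinear_eigenproblem A f Y \<epsilon> \<mu> \<psi> \<longleftrightarrow>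
     \<psi> \<in> dom A \<inter> Y \<and> (A \<bullet>\<^sub>o \<psi> - \<mu> *\<^sub>C \<psi>) - \<epsilon> *\<^sub>R f \<psi> = 0"

end

theory Submission
  imports Defs
begin

text \<open>The function \<open>\<psi>(\<epsilon>)\<close> solves \<open>(A - \<mu>)\<psi> = \<epsilon> f(\<psi>)\<close>, because \<open>A\<^sup>*\<psi>\<^sub>0\<^sup>* = cnj \<mu>\<^sub>0 \<psi>\<^sub>0\<^sup>*\<close> makes the
  outer \<open>Q\<^sub>0\<close> in \<open>Q\<^sub>0(A - \<mu>\<^sub>0)Q\<^sub>0\<close> superfluous; dividing by the norm and using homogeneity gives the
  normalised equation. For the injectivity it suffices that \<open>\<epsilon> \<mapsto> \<psi>(\<epsilon>)\<close> is Lipschitz near 0, since then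
  \<open>\<epsilon> \<mapsto> \<epsilon> \<parallel>\<psi>(\<epsilon>)\<parallel>\<^bsup>q-1\<^esup>\<close> is a Lipschitz-small perturbation of the identity. The Lipschitz bound follows by
  subtracting the equations of the corrections \<open>\<chi>\<close> for two parameters: the right-hand side carries a factor
  \<open>\<epsilon>\<close>, so that the terms containing the difference of the corrections can be absorbed. Inverting
  \<open>Q\<^sub>0(A - \<mu>\<^sub>0)Q\<^sub>0\<close> requires its injectivity, which holds as every eigenvector for \<open>\<mu>\<^sub>0\<close> is fixed by the Riesz
  projections, whose range is one-dimensional.\<close>

section \<open>Complex Hilbert spaces\<close>

lemma cinner_zero_left [simp]: "cinner 0 y = 0"
  by (metis cinner_scaleC_left complex_vector.scale_zero_left mult_zero_left)

lemma cinner_minus_left: "cinner (- x) y = - cinner x y"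
  using cinner_add_left[of x "- x" y] by (simp add: eq_neg_iff_add_eq_0 add.commute)

lemma cinner_diff_left: "cinner (x - y) z = cinner x z - cinner y z"
  using cinner_add_left[of x "- y" z] by (simp add: cinner_minus_left)

lemma cinner_scaleR_left: "cinner (r *\<^sub>R x) y = of_real r * cinner x y"
  by (simp add: scaleR_scaleC cinner_scaleC_left)

lemma cinner_diff_right: "cinner x (y - z) = cinner x y - cinner x z"
  by (metis cinner_commute cinner_diff_left complex_cnj_diff)

lemma cinner_scaleC_right: "cinner x (c *\<^sub>C y) = cnj c * cinner x y"
  by (metis cinner_commute cinner_scaleC_left complex_cnj_mult)

lemma cinner_self: "cinner x x = of_real ((norm x)\<^sup>2)"
  using cinner_self_nonneg[of x] by (auto simp: norm_eq_sqrt_cinner elim!: Reals_cases)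

lemma norm_scaleC: "norm (c *\<^sub>C x) = cmod c * norm x"
proof -
  have "cinner (c *\<^sub>C x) (c *\<^sub>C x) = c * cnj c * cinner x x"
    by (simp add: cinner_scaleC_left cinner_scaleC_right)
  then have "complex_of_real ((norm (c *\<^sub>C x))\<^sup>2) = c * cnj c * of_real ((norm x)\<^sup>2)"
    unfolding cinner_self .
  also have "\<dots> = of_real ((cmod c * norm x)\<^sup>2)"
    by (simp add: complex_norm_square[symmetric] power_mult_distrib)
  finally have "(norm (c *\<^sub>C x))\<^sup>2 = (cmod c * norm x)\<^sup>2"
    using of_real_eq_iff by blast
  then show ?thesis
    by (simp add: power2_eq_iff_nonneg)
qed

text \<open>The residual \<open>z\<close> of projecting \<open>x\<close> onto \<open>y\<close> is
  orthogonal to \<open>y\<close>, so its squared norm is that of \<open>x\<close> minus the square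
  of \<open>cmod (cinner x y) / norm y\<close>, and it is nonnegative.\<close>

lemma cauchy_schwarz_cinner: "cmod (cinner x y) \<le> norm x * norm y"
proof (cases "y = 0")
  case True
  then show ?thesis
    using cinner_commute[of x y] by simp
next
  case False
  define c where "c = cinner x y / cinner y y"
  define z where "z = x - c *\<^sub>C y"
  have y: "cinner y y \<noteq> 0"
    using False by (simp add: cinner_self)
  have "cinner z y = 0"
    using y by (simp add: z_def c_def cinner_diff_left cinner_scaleC_left)
  then have "cinner z z = cinner z x"
    by (metis z_def cinner_diff_right cinner_scaleC_right mult_zero_right diff_zero)
  also have "\<dots> = cinner x x - cinner x y * cnj (cinner x y) / cinner y y"
    using cinner_commute[of y x]
    by (simp add: z_def c_def cinner_diff_left cinner_scaleC_left)
  finally have "complex_of_real ((norm z)\<^sup>2) =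
      of_real ((norm x)\<^sup>2 - (cmod (cinner x y))\<^sup>2 / (norm y)\<^sup>2)"
    by (simp add: cinner_self complex_norm_square[symmetric])
  then have "(norm z)\<^sup>2 = (norm x)\<^sup>2 - (cmod (cinner x y))\<^sup>2 / (norm y)\<^sup>2"
    using of_real_eq_iff by blast
  then have "(cmod (cinner x y))\<^sup>2 / (norm y)\<^sup>2 \<le> (norm x)\<^sup>2"
    by (smt (verit) zero_le_power2)
  then have "(cmod (cinner x y))\<^sup>2 \<le> (norm x * norm y)\<^sup>2"
    using False by (simp add: divide_le_eq power_mult_distrib)
  then show ?thesis
    by (rule power2_le_imp_le) simp
qed

text \<open>\<open>adjoint_op\<close> picks its value by a definite description, so uniqueness must
  come first. Density supplies it: a difference of two candidates is orthogonal to
  \<open>dom A\<close>.\<close>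

lemma adjoint_op_cinner:
  assumes dense: "densely_defined A" and y: "y \<in> dom (adjoint_op A)" and x: "x \<in> dom A"
  shows "cinner (A \<bullet>\<^sub>o x) y = cinner x (adjoint_op A \<bullet>\<^sub>o y)"
proof -
  let ?adj = "\<lambda>z. \<forall>x\<in>dom A. cinner (A \<bullet>\<^sub>o x) y = cinner x z"
  have ex: "\<exists>z. ?adj z"
    using y by (auto simp: adjoint_op_def split: if_splits)
  have "z = z'" if z: "?adj z" "?adj z'" for z z'
  proof (rule ccontr)
    assume "z \<noteq> z'"
    define w where "w = z - z'"
    have w: "norm w > 0"
      using \<open>z \<noteq> z'\<close> by (simp add: w_def)
    have orth: "cinner u w = 0" if "u \<in> dom A" for u
      using z that by (simp add: w_def cinner_diff_right)
    have "w \<in> closure (dom A)"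
      using dense by (simp add: densely_defined_def)
    then obtain u where u: "u \<in> dom A" "dist u w < norm w"
      using w closure_approachable by metis
    have "(norm w)\<^sup>2 = cmod (cinner w w)"
      by (metis cinner_self norm_of_real abs_of_nonneg zero_le_power2)
    \<comment> \<open>Subtracting \<open>u\<close> is free by orthogonality and makes the first
      factor in Cauchy-Schwarz smaller than the norm of \<open>w\<close>.\<close>
    also have "cinner w w = cinner (w - u) w"
      by (simp add: cinner_diff_left orth[OF u(1)])
    also have "cmod \<dots> \<le> norm (w - u) * norm w"
      by (rule cauchy_schwarz_cinner)
    also have "\<dots> < norm w * norm w"
      using u(2) w by (simp add: dist_norm norm_minus_commute)
    finally show False
      by (simp add: power2_eq_square)
  qed
  then have "\<exists>!z. ?adj z"
    using ex by (intro ex_ex1I)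
  then have "?adj (THE z. ?adj z)"
    by (rule theI')
  then show ?thesis
    using ex x by (simp add: adjoint_op_def)
qed

section \<open>Operators, their powers and graph norms\<close>

lemma linear_operator_subspace: "linear_operator A \<Longrightarrow> complex_vector.subspace (dom A)"
  and linear_operator_add:
    "linear_operator A \<Longrightarrow> x \<in> dom A \<Longrightarrow> y \<in> dom A \<Longrightarrow> A \<bullet>\<^sub>o (x + y) = A \<bullet>\<^sub>o x + A \<bullet>\<^sub>o y"
  and linear_operator_scaleC:
    "linear_operator A \<Longrightarrow> x \<in> dom A \<Longrightarrow> A \<bullet>\<^sub>o (c *\<^sub>C x) = c *\<^sub>C (A \<bullet>\<^sub>o x)"
  by (auto simp: linear_operator_def)

lemma linear_operator_diff:
  assumes "linear_operator A" "x \<in> dom A" "y \<in> dom A"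
  shows "A \<bullet>\<^sub>o (x - y) = A \<bullet>\<^sub>o x - A \<bullet>\<^sub>o y"
  using linear_operator_add[OF assms(1), of "x - y" y]
    complex_vector.subspace_diff[OF linear_operator_subspace[OF assms(1)] assms(2,3)] assms(3)
  by simp

lemma subspace_scaleR: "complex_vector.subspace S \<Longrightarrow> x \<in> S \<Longrightarrow> r *\<^sub>R x \<in> S"
  by (simp add: scaleR_scaleC complex_vector.subspace_scale)

lemma linear_operator_map_comp:
  assumes A: "linear_operator A" and B: "linear_operator B"
  shows "linear_operator (A \<circ>\<^sub>m B)"
proof -
  have dom: "x \<in> dom (A \<circ>\<^sub>m B) \<longleftrightarrow> x \<in> dom B \<and> B \<bullet>\<^sub>o x \<in> dom A" for x
    by (auto simp: map_comp_def split: option.splits)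
  have app: "(A \<circ>\<^sub>m B) \<bullet>\<^sub>o x = A \<bullet>\<^sub>o B \<bullet>\<^sub>o x" if "x \<in> dom B" for x
    using that by (auto simp: map_comp_def)
  note sA = linear_operator_subspace[OF A] and sB = linear_operator_subspace[OF B]
  \<comment> \<open>This places 0 in the domain of the composition, as the subspace property
    requires.\<close>
  have "B \<bullet>\<^sub>o 0 = 0"
    using linear_operator_scaleC[OF B complex_vector.subspace_0[OF sB], of 0] by simp
  then show ?thesis
    using sA sB
    by (auto simp: linear_operator_def complex_vector.subspace_def dom app
        linear_operator_add[OF A] linear_operator_add[OF B]
        linear_operator_scaleC[OF A] linear_operator_scaleC[OF B] simp del: map_comp_Some_iff)
qed

lemma linear_operator_Some: "linear_operator Some"
  by (simp add: linear_operator_def complex_vector.subspace_UNIV dom_def)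

lemma linear_operator_op_pow: "linear_operator A \<Longrightarrow> linear_operator (op_pow A k)"
  by (induction k) (auto intro: linear_operator_map_comp linear_operator_Some)

text \<open>The definition adds a new factor \<open>A\<close> on the outside; splitting off the
  innermost one lets the domain of a power be entered through the value of \<open>A\<close> at
  \<open>x\<close>.\<close>

lemma op_pow_Suc_right: "op_pow A (Suc k) = op_pow A k \<circ>\<^sub>m A"
proof (induction k)
  case 0
  show ?case
    by (auto simp: map_comp_def split: option.splits)
next
  case (Suc k)
  have "op_pow A (Suc (Suc k)) = A \<circ>\<^sub>m (op_pow A k \<circ>\<^sub>m A)"
    using Suc by simp
  then show ?case
    by (auto simp: map_comp_def fun_eq_iff split: option.splits)
qed

lemma dom_op_pow_Suc_right:
  "x \<in> dom A \<Longrightarrow> A \<bullet>\<^sub>o x \<in> dom (op_pow A k) \<Longrightarrow> x \<in> dom (op_pow A (Suc k))"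
  unfolding op_pow_Suc_right by (auto simp: map_comp_def)

lemma dom_op_pow_antimono: "k \<le> m \<Longrightarrow> dom (op_pow A m) \<subseteq> dom (op_pow A k)"
proof (induction m rule: dec_induct)
  case (step m)
  have "dom (op_pow A (Suc m)) \<subseteq> dom (op_pow A m)"
    by (auto simp: map_comp_def split: option.splits)
  with step.IH show ?case
    by blast
qed simp

text \<open>Bootstrapping: \<open>A x\<close> is the sum of \<open>A x - c x\<close> and
  \<open>c x\<close>, so while the order of \<open>x\<close> is at most \<open>m\<close>,
  \<open>A x\<close> has the same order and \<open>x\<close> gains one more.\<close>

lemma dom_op_pow_regularity:
  assumes A: "linear_operator A" and x: "x \<in> dom A"
    and y: "A \<bullet>\<^sub>o x - c *\<^sub>C x \<in> dom (op_pow A m)"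
  shows "x \<in> dom (op_pow A (Suc m))"
proof -
  have "x \<in> dom (op_pow A (Suc k))" if "k \<le> m" for k
    using that
  proof (induction k)
    case 0
    show ?case
      using x by (intro dom_op_pow_Suc_right) (simp_all add: dom_def)
  next
    case (Suc k)
    note s = linear_operator_subspace[OF linear_operator_op_pow[OF A, of "Suc k"]]
    have "A \<bullet>\<^sub>o x - c *\<^sub>C x \<in> dom (op_pow A (Suc k))"
      using y dom_op_pow_antimono[OF Suc.prems] by blast
    moreover have "c *\<^sub>C x \<in> dom (op_pow A (Suc k))"
      using Suc by (intro complex_vector.subspace_scale[OF s]) simp
    ultimately have "(A \<bullet>\<^sub>o x - c *\<^sub>C x) + c *\<^sub>C x \<in> dom (op_pow A (Suc k))"
      by (rule complex_vector.subspace_add[OF s])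
    then show ?case
      by (intro dom_op_pow_Suc_right[OF x, of "Suc k"]) (simp del: op_pow.simps)
  qed
  then show ?thesis
    by simp
qed

lemma graph_norm_nonneg: "0 \<le> graph_norm A m x"
  by (simp add: graph_norm_def sum_nonneg)

lemma norm_le_graph_norm: "norm x \<le> graph_norm A m x"
proof -
  have "norm (op_pow A 0 \<bullet>\<^sub>o x) \<le> graph_norm A m x"
    unfolding graph_norm_def by (rule member_le_sum) auto
  then show ?thesis
    by simp
qed

lemma graph_norm_add:
  assumes A: "linear_operator A" and x: "x \<in> dom (op_pow A m)" and y: "y \<in> dom (op_pow A m)"
  shows "graph_norm A m (x + y) \<le> graph_norm A m x + graph_norm A m y"
  unfolding graph_norm_def sum.distrib[symmetric]
proof (rule sum_mono)
  fix k assume "k \<in> {..m}"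
  then have "x \<in> dom (op_pow A k)" "y \<in> dom (op_pow A k)"
    using dom_op_pow_antimono[of k m A] x y by auto
  then show "norm (op_pow A k \<bullet>\<^sub>o (x + y)) \<le> norm (op_pow A k \<bullet>\<^sub>o x) + norm (op_pow A k \<bullet>\<^sub>o y)"
    using linear_operator_add[OF linear_operator_op_pow[OF A]] norm_triangle_ineq by metis
qed

lemma graph_norm_scaleC:
  assumes A: "linear_operator A" and x: "x \<in> dom (op_pow A m)"
  shows "graph_norm A m (c *\<^sub>C x) = cmod c * graph_norm A m x"
  unfolding graph_norm_def sum_distrib_left
proof (rule sum.cong)
  fix k assume "k \<in> {..m}"
  then have "x \<in> dom (op_pow A k)"
    using dom_op_pow_antimono[of k m A] x by auto
  then show "norm (op_pow A k \<bullet>\<^sub>o (c *\<^sub>C x)) = cmod c * norm (op_pow A k \<bullet>\<^sub>o x)"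
    by (simp add: linear_operator_scaleC[OF linear_operator_op_pow[OF A]] norm_scaleC)
qed simp

section \<open>The complementary projection along \<open>\<psi>0\<close>\<close>

lemma Q0_diff: "Q0 p p' (x - y) = Q0 p p' x - Q0 p p' y"
  by (simp add: Q0_def P0_def cinner_diff_left complex_vector.scale_left_diff_distrib)

lemma Q0_eq_self_iff: "p \<noteq> 0 \<Longrightarrow> Q0 p p' x = x \<longleftrightarrow> cinner x p' = 0"
  by (simp add: Q0_def P0_def)

lemma cinner_Q0: "cinner p p' = 1 \<Longrightarrow> cinner (Q0 p p' x) p' = 0"
  by (simp add: Q0_def P0_def cinner_diff_left cinner_scaleC_left)

section \<open>Simple eigenvalues\<close>

text \<open>On an eigenvector the resolvent at \<open>\<mu> + z\<close> is multiplication by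
  \<open>- 1 / z\<close>, so the integrand is the constant \<open>- x\<close> over an interval of
  length \<open>2 * pi\<close>.\<close>

lemma riesz_projection_eigenvector:
  assumes A: "linear_operator A" and x: "x \<in> dom A" "A \<bullet>\<^sub>o x = \<mu> *\<^sub>C x"
    and r: "r > 0" and circle: "\<And>t. \<mu> + of_real r * cis t \<in> resolvent_set A"
  shows "riesz_projection A \<mu> r x = x"
proof -
  have "(of_real r * cis t) *\<^sub>C resolvent A (\<mu> + of_real r * cis t) x = - x" for t
  proof -
    define z where "z = of_real r * cis t"
    have z: "z \<noteq> 0"
      using r by (simp add: z_def)
    define y where "y = (- 1 / z) *\<^sub>C x"
    have y: "y \<in> dom A"
      unfolding y_def by (intro complex_vector.subspace_scale linear_operator_subspace A x)
    have "A \<bullet>\<^sub>o y - (\<mu> + z) *\<^sub>C y = (- 1 / z * \<mu> - (\<mu> + z) * (- 1 / z)) *\<^sub>C x"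
      by (simp only: y_def linear_operator_scaleC[OF A x(1)] x(2) scaleC_scaleC
          complex_vector.scale_left_diff_distrib)
    also have "- 1 / z * \<mu> - (\<mu> + z) * (- 1 / z) = 1"
      using z by (simp add: field_simps)
    finally have Ay: "A \<bullet>\<^sub>o y - (\<mu> + z) *\<^sub>C y = x"
      by (simp add: scaleC_one)
    have "inj_on (\<lambda>x. A \<bullet>\<^sub>o x - (\<mu> + z) *\<^sub>C x) (dom A)"
      using circle[of t] by (simp add: resolvent_set_def z_def bij_betw_def)
    from inv_into_f_f[OF this y] have "resolvent A (\<mu> + z) x = y"
      by (simp add: resolvent_def Ay)
    then have "z *\<^sub>C resolvent A (\<mu> + z) x = - x"
      using z by (simp add: y_def scaleC_scaleC scaleC_one)
    then show ?thesis
      by (simp add: z_def)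
  qed
  then show ?thesis
    by (simp add: riesz_projection_def)
qed

text \<open>A common Riesz projection fixes both vectors, which puts them into the span of a single
  one; since \<open>y\<close> is nonzero, its coefficient can be divided out.\<close>

lemma simple_eigenvalue_eigenspace:
  assumes A: "linear_operator A" and simple: "isolated_simple_eigenvalue A \<mu>"
    and x: "x \<in> dom A" "A \<bullet>\<^sub>o x = \<mu> *\<^sub>C x" and y: "y \<in> dom A" "A \<bullet>\<^sub>o y = \<mu> *\<^sub>C y" "y \<noteq> 0"
  shows "\<exists>c. x = c *\<^sub>C y"
proof -
  obtain T where T: "open T" "T \<inter> spectrum A = {\<mu>}"
    using simple by (auto simp: isolated_simple_eigenvalue_def isolated_in_def)
  then obtain d where d: "d > 0" "ball \<mu> d \<subseteq> T"
    by (metis Int_iff insertI1 open_contains_ball)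
  have "\<forall>\<^sub>F r in at_right 0. complex_vector.dim (range (riesz_projection A \<mu> r)) = 1"
    using simple by (simp add: isolated_simple_eigenvalue_def has_algebraic_multiplicity_def)
  \<comment> \<open>The multiplicity is known only for small radii, and the circle must also stay
    within the isolating ball; both hold eventually.\<close>
  moreover have "\<forall>\<^sub>F r in at_right 0. r \<in> {0<..<d}"
    using d(1) by (rule eventually_at_right_real)
  ultimately have "\<forall>\<^sub>F r in at_right 0.
      complex_vector.dim (range (riesz_projection A \<mu> r)) = 1 \<and> r \<in> {0<..<d}"
    by (rule eventually_conj)
  then obtain r where r: "complex_vector.dim (range (riesz_projection A \<mu> r)) = 1" "0 < r" "r < d"
    using eventually_happens[of _ "at_right (0::real)"] by auto
  have circle: "\<mu> + of_real r * cis t \<in> resolvent_set A" for t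
  proof -
    have "\<mu> + of_real r * cis t \<in> T"
      using r d(2) by (auto simp: dist_norm norm_mult)
    moreover have "\<mu> + of_real r * cis t \<noteq> \<mu>"
      using r by simp
    ultimately show ?thesis
      using T(2) by (metis Compl_iff Int_iff singletonD spectrum_def)
  qed
  obtain B where B: "range (riesz_projection A \<mu> r) \<subseteq> complex_vector.span B" "card B = 1"
    using complex_vector.basis_exists r(1) by metis
  then obtain b where b: "range (riesz_projection A \<mu> r) \<subseteq> complex_vector.span {b}"
    by (metis card_1_singletonE)
  have "x \<in> complex_vector.span {b}" "y \<in> complex_vector.span {b}"
    using b riesz_projection_eigenvector[OF A x r(2) circle]
      riesz_projection_eigenvector[OF A y(1,2) r(2) circle] by (metis rangeI subsetD)+
  then obtain c c' where c: "x = c *\<^sub>C b" "y = c' *\<^sub>C b"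
    by (auto simp: complex_vector.span_singleton)
  with y(3) have "c' \<noteq> 0"
    by auto
  then have "x = (c / c') *\<^sub>C y"
    by (simp add: c scaleC_scaleC)
  then show ?thesis ..
qed

section \<open>Lipschitz perturbations of the identity\<close>

text \<open>On an interval bounded away from 0 the derivative is continuous for every real exponent,
  hence bounded by compactness.\<close>

lemma powr_lipschitz_near_one:
  fixes p :: real
  obtains B where "B-lipschitz_on {1/2..3/2} (\<lambda>x. x powr p)"
proof -
  let ?S = "{1/2..3/2::real}" and ?f' = "\<lambda>x::real. p * x powr (p - 1)"
  have "compact (?f' ` ?S)"
    by (intro compact_continuous_image continuous_intros) auto
  then have "bounded (?f' ` ?S)"
    by (rule compact_imp_bounded)
  then obtain B where B: "B > 0" "\<And>x. x \<in> ?S \<Longrightarrow> norm (?f' x) \<le> B"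
    unfolding bounded_pos by blast
  have "B-lipschitz_on ?S (\<lambda>x. x powr p)"
  proof (rule lipschitz_onI)
    fix x y assume xy: "x \<in> ?S" "y \<in> ?S"
    have deriv: "((\<lambda>x. x powr p) has_real_derivative ?f' z) (at z within ?S)" if "z \<in> ?S" for z
      using that by (intro DERIV_subset[OF has_real_derivative_powr]) auto
    show "dist (x powr p) (y powr p) \<le> B * dist x y"
      unfolding dist_norm
      by (rule field_differentiable_bound[OF _ deriv B(2) xy]) auto
  qed (use B in simp)
  then show ?thesis ..
qed

text \<open>Equal values at \<open>s\<close> and \<open>t\<close> give
  \<open>(s - t) * h s = t * (h t - h s)\<close>. Near 0 the factor \<open>h s\<close> exceeds 1/2,
  while the right side is at most \<open>B * K * d * |s - t|\<close> in modulus, which forces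
  \<open>s = t\<close>.\<close>

lemma inj_on_mult_norm_powr:
  fixes g :: "real \<Rightarrow> 'a::real_normed_vector"
  assumes e: "e > 0" and g: "K-lipschitz_on (ball 0 e) g" and g0: "norm (g 0) = 1"
  obtains d where "0 < d" "d \<le> e" "inj_on (\<lambda>t. t * norm (g t) powr p) (ball 0 d)"
proof -
  obtain B where B: "B-lipschitz_on {1/2..3/2} (\<lambda>x. x powr p)"
    using powr_lipschitz_near_one .
  note K0 = lipschitz_on_nonneg[OF g] and B0 = lipschitz_on_nonneg[OF B]
  define h where "h t = norm (g t) powr p" for t
  \<comment> \<open>One bound serves twice: it keeps the norm of \<open>g\<close> within [1/2, 3/2],
    where \<open>B\<close> applies, and yields \<open>B * K * d < 1 / 2\<close>. The added ones keep
    the denominator positive and the latter inequality strict.\<close>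
  define d where "d = min e (1 / (2 * (K + 1) * (B + 1)))"
  have "d > 0" "d \<le> e" and d: "d \<le> 1 / (2 * (K + 1) * (B + 1))"
    using e K0 B0 by (auto simp: d_def)
  have "d * (2 * (K + 1) * (B + 1)) \<le> 1"
    using d K0 B0 by (simp add: pos_le_divide_eq)
  then have dKB: "2 * d * (K + 1) * (B + 1) \<le> 1"
    by (simp add: algebra_simps)
  have "(K + 1) * d * 1 \<le> (K + 1) * d * (B + 1)"
    using K0 B0 \<open>d > 0\<close> by (intro mult_left_mono) auto
  then have d': "(K + 1) * d \<le> 1 / 2"
    using dKB by (simp add: algebra_simps)
  have range: "norm (g t) \<in> {1/2..3/2}" if "t \<in> ball 0 d" for t
  proof -
    have "norm (g t - g 0) \<le> K * norm (t - 0)"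
      using that \<open>d \<le> e\<close> e by (intro lipschitz_on_normD[OF g]) auto
    also have "\<dots> \<le> (K + 1) * d"
      using that K0 by (intro mult_mono) auto
    finally have "norm (g t - g 0) \<le> 1 / 2"
      using d' by linarith
    then show ?thesis
      using g0 norm_triangle_ineq3[of "g t" "g 0"] by (auto simp: abs_le_iff)
  qed
  have lip: "\<bar>h s - h t\<bar> \<le> B * (K * \<bar>s - t\<bar>)" if st: "s \<in> ball 0 d" "t \<in> ball 0 d" for s t
  proof -
    have "\<bar>h s - h t\<bar> \<le> B * \<bar>norm (g s) - norm (g t)\<bar>"
      using lipschitz_on_normD[OF B range[OF st(1)] range[OF st(2)]] by (simp add: h_def)
    also have "\<bar>norm (g s) - norm (g t)\<bar> \<le> norm (g s - g t)"
      by (rule norm_triangle_ineq3)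
    also have "\<dots> \<le> K * \<bar>s - t\<bar>"
      using lipschitz_on_normD[OF g, of s t] st \<open>d \<le> e\<close> by simp
    finally show ?thesis
      using B0 by (simp add: mult_left_mono)
  qed
  have "h 0 = 1"
    by (simp add: h_def g0)
  have "inj_on (\<lambda>t. t * h t) (ball 0 d)"
  proof (rule inj_onI, rule ccontr)
    fix s t assume st: "s \<in> ball 0 d" "t \<in> ball 0 d" "s * h s = t * h t" "s \<noteq> t"
    have BK: "B * K * d < 1 / 2"
    proof -
      have "2 * (B * K * d) < 2 * d * (K + 1) * (B + 1)"
        using K0 B0 \<open>d > 0\<close> by (simp add: algebra_simps add_pos_nonneg)
      then show ?thesis
        using dKB by linarith
    qed
    have "\<bar>h s - 1\<bar> \<le> B * (K * \<bar>s\<bar>)"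
      using lip[OF st(1), of 0] \<open>d > 0\<close> \<open>h 0 = 1\<close> by simp
    also have "\<dots> \<le> B * (K * d)"
      using st(1) K0 B0 by (intro mult_left_mono) auto
    finally have hs: "h s > 1 / 2"
      using BK by (simp add: mult.assoc)
    have "\<bar>s - t\<bar> * (1 / 2) \<le> \<bar>s - t\<bar> * h s"
      using hs by (intro mult_left_mono) auto
    also have "\<dots> = \<bar>(s - t) * h s\<bar>"
      using hs by (simp add: abs_mult)
    also have "(s - t) * h s = t * (h t - h s)"
      using st(3) by (simp add: algebra_simps)
    also have "\<bar>\<dots>\<bar> \<le> d * (B * (K * \<bar>t - s\<bar>))"
      unfolding abs_mult using st(2) lip[OF st(2,1)] by (intro mult_mono) auto
    also have "\<dots> = B * K * d * \<bar>s - t\<bar>"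
      by (simp add: algebra_simps abs_minus_commute)
    also have "\<dots> < 1 / 2 * \<bar>s - t\<bar>"
      using BK st(4) by (intro mult_strict_right_mono) auto
    finally show False
      by simp
  qed
  with \<open>d > 0\<close> \<open>d \<le> e\<close> show ?thesis
    by (intro that) (auto simp: h_def)
qed

section \<open>The nonlinear eigenpair\<close>

context basic_assumption
begin

lemma banach_Y_subspace: "complex_vector.subspace Y"
  and normY_nonneg: "x \<in> Y \<Longrightarrow> 0 \<le> normY x"
  and normY_add: "x \<in> Y \<Longrightarrow> y \<in> Y \<Longrightarrow> normY (x + y) \<le> normY x + normY y"
  and normY_scaleC: "x \<in> Y \<Longrightarrow> normY (c *\<^sub>C x) = cmod c * normY x"
  using banach_Y by (auto simp: banach_subspace_def)

lemma normY_zero: "normY 0 = 0"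
  using banach_Y by (auto simp: banach_subspace_def complex_vector.subspace_def)

lemma dom_op_pow_n: "dom (op_pow A n) \<subseteq> dom (op_pow A (n - 1))"
  by (rule dom_op_pow_antimono) simp

lemma dom_op_pow_n_dom: "dom (op_pow A n) \<subseteq> dom A"
  using dom_op_pow_antimono[OF n_ge_1, of A] by (simp add: dom_def)

lemma subspace_dom_op_pow: "complex_vector.subspace (dom (op_pow A k))"
  by (rule linear_operator_subspace[OF linear_operator_op_pow[OF linear_A]])

lemma op_sub_scaleC_dom_imp_dom_op_pow:
  "x \<in> dom A \<Longrightarrow> A \<bullet>\<^sub>o x - c *\<^sub>C x \<in> dom (op_pow A (n - 1)) \<Longrightarrow> x \<in> dom (op_pow A n)"
  using dom_op_pow_regularity[OF linear_A, of x c "n - 1"] n_ge_1 by simp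

text \<open>\<open>A - \<mu>0\<close> sends \<open>\<psi>0\<close> to 0, which lies in every domain,
  so regularity applies.\<close>

lemma \<psi>0_mem: "\<psi>0 \<in> dom (op_pow A n)"
  using complex_vector.subspace_0[OF subspace_dom_op_pow]
  by (intro op_sub_scaleC_dom_imp_dom_op_pow[where c = \<mu>0]) (simp_all add: \<psi>0_dom \<psi>0_eigen)

text \<open>Moving \<open>A\<close> to the second argument produces the conjugate of
  \<open>cnj \<mu>0\<close>, and the two terms cancel. Hence the range of \<open>A - \<mu>0\<close>
  lies in the kernel of \<open>P0\<close>.\<close>

lemma cinner_op_\<psi>0s: "x \<in> dom A \<Longrightarrow> cinner (A \<bullet>\<^sub>o x - \<mu>0 *\<^sub>C x) \<psi>0s = 0"
  by (simp add: cinner_diff_left cinner_scaleC_left adjoint_op_cinner[OF dense_A \<psi>0s_dom]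
      \<psi>0s_eigen cinner_scaleC_right)

lemma \<psi>0_nonzero: "\<psi>0 \<noteq> 0"
  using \<psi>0_norm by auto

lemma Q0_eq_self: "cinner x \<psi>0s = 0 \<Longrightarrow> Q0 \<psi>0 \<psi>0s x = x"
  by (simp add: Q0_eq_self_iff[OF \<psi>0_nonzero])

text \<open>Turns membership in a projected domain into a linear side condition. The assumption on
  \<open>\<psi>0\<close> ensures that \<open>Q0\<close> subtracts an element of
  \<open>S\<close>.\<close>

lemma mem_Q0_image_iff:
  assumes "complex_vector.subspace S" "\<psi>0 \<in> S"
  shows "x \<in> Q0 \<psi>0 \<psi>0s ` S \<longleftrightarrow> x \<in> S \<and> cinner x \<psi>0s = 0"
proof
  assume "x \<in> Q0 \<psi>0 \<psi>0s ` S"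
  then obtain y where y: "y \<in> S" "x = Q0 \<psi>0 \<psi>0s y"
    by blast
  then show "x \<in> S \<and> cinner x \<psi>0s = 0"
    using assms cinner_Q0[OF \<psi>0_\<psi>0s]
    by (auto simp: Q0_def P0_def intro!: complex_vector.subspace_diff complex_vector.subspace_scale)
next
  assume "x \<in> S \<and> cinner x \<psi>0s = 0"
  then show "x \<in> Q0 \<psi>0 \<psi>0s ` S"
    using Q0_eq_self by (metis image_eqI)
qed

lemmas mem_Q0_dom_iff = mem_Q0_image_iff[OF linear_operator_subspace[OF linear_A] \<psi>0_dom]

lemmas mem_Q0_dom_op_pow_iff =
  mem_Q0_image_iff[OF subspace_dom_op_pow subsetD[OF dom_op_pow_n \<psi>0_mem]]

lemma reduced_op_eq:
  assumes "x \<in> Q0 \<psi>0 \<psi>0s ` dom A"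
  shows "reduced_op A \<mu>0 \<psi>0 \<psi>0s x = A \<bullet>\<^sub>o x - \<mu>0 *\<^sub>C x"
  using assms by (simp add: reduced_op_def mem_Q0_dom_iff Q0_eq_self cinner_op_\<psi>0s)

text \<open>Two preimages differ by an element of the eigenspace, i.e. a multiple of
  \<open>\<psi>0\<close>, and pairing with \<open>\<psi>0s\<close> kills the coefficient. This makes
  \<open>reduced_inverse\<close>, an \<open>inv_into\<close>, a true left inverse.\<close>

lemma inj_on_reduced_op: "inj_on (reduced_op A \<mu>0 \<psi>0 \<psi>0s) (Q0 \<psi>0 \<psi>0s ` dom A)"
proof (rule inj_onI)
  fix x y assume xy: "x \<in> Q0 \<psi>0 \<psi>0s ` dom A" "y \<in> Q0 \<psi>0 \<psi>0s ` dom A"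
    and eq: "reduced_op A \<mu>0 \<psi>0 \<psi>0s x = reduced_op A \<mu>0 \<psi>0 \<psi>0s y"
  have dom: "x \<in> dom A" "y \<in> dom A" "cinner x \<psi>0s = 0" "cinner y \<psi>0s = 0"
    using xy by (simp_all add: mem_Q0_dom_iff)
  have "A \<bullet>\<^sub>o (x - y) = \<mu>0 *\<^sub>C (x - y)"
    unfolding linear_operator_diff[OF linear_A dom(1,2)] complex_vector.scale_right_diff_distrib
    using eq by (simp add: reduced_op_eq[OF xy(1)] reduced_op_eq[OF xy(2)] algebra_simps)
  then obtain c where c: "x - y = c *\<^sub>C \<psi>0"
    using simple_eigenvalue_eigenspace[OF linear_A simple_\<mu>0 _ _ \<psi>0_dom \<psi>0_eigen \<psi>0_nonzero]
      complex_vector.subspace_diff[OF linear_operator_subspace[OF linear_A] dom(1,2)] by blast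
  have "c = cinner (x - y) \<psi>0s"
    by (simp add: c cinner_scaleC_left \<psi>0_\<psi>0s)
  also have "\<dots> = 0"
    by (simp add: cinner_diff_left dom)
  finally show "x = y"
    using c by simp
qed

lemma norm_cinner_\<psi>0s_le: "cmod (cinner x \<psi>0s) \<le> graph_norm A k x * norm \<psi>0s"
  by (rule order_trans[OF cauchy_schwarz_cinner])
    (simp add: mult_right_mono norm_le_graph_norm)

text \<open>The rank-one part is controlled since pairing with \<open>\<psi>0s\<close> is bounded in
  \<open>norm\<close>, the zeroth term of the graph norm.\<close>

lemma graph_norm_Q0:
  assumes "x \<in> dom (op_pow A (n - 1))"
  shows "graph_norm A (n - 1) (Q0 \<psi>0 \<psi>0s x)
    \<le> (1 + norm \<psi>0s * graph_norm A (n - 1) \<psi>0) * graph_norm A (n - 1) x"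
proof -
  note s = subspace_dom_op_pow[of "n - 1"]
  have \<psi>0: "\<psi>0 \<in> dom (op_pow A (n - 1))"
    using \<psi>0_mem dom_op_pow_n by blast
  have "Q0 \<psi>0 \<psi>0s x = x + (- cinner x \<psi>0s) *\<^sub>C \<psi>0"
    by (simp add: Q0_def P0_def)
  then have "graph_norm A (n - 1) (Q0 \<psi>0 \<psi>0s x)
      \<le> graph_norm A (n - 1) x + graph_norm A (n - 1) ((- cinner x \<psi>0s) *\<^sub>C \<psi>0)"
    using graph_norm_add[OF linear_A assms complex_vector.subspace_scale[OF s \<psi>0]] by metis
  also have "graph_norm A (n - 1) ((- cinner x \<psi>0s) *\<^sub>C \<psi>0)
      = cmod (cinner x \<psi>0s) * graph_norm A (n - 1) \<psi>0"
    by (subst graph_norm_scaleC[OF linear_A \<psi>0]) simp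
  also have "\<dots> \<le> (graph_norm A (n - 1) x * norm \<psi>0s) * graph_norm A (n - 1) \<psi>0"
    by (intro mult_right_mono norm_cinner_\<psi>0s_le graph_norm_nonneg)
  finally show ?thesis
    by (simp add: algebra_simps)
qed

end

section \<open>The branch of nonlinear eigenvectors\<close>

locale nonlinear_branch =
  basic_assumption A f Y normY n \<mu>0 \<psi>0 \<psi>0s k1 k2 rL L
  for A :: "'h::complex_hilbert \<rightharpoonup> 'h" and f Y normY n \<mu>0 \<psi>0 \<psi>0s k1 k2 rL L +
  fixes \<phi> :: 'h and C r1 r2 \<epsilon>0 :: real
  assumes \<phi>_mem: "\<phi> \<in> Q0 \<psi>0 \<psi>0s ` dom A"
    and \<phi>_eq: "A \<bullet>\<^sub>o \<phi> - \<mu>0 *\<^sub>C \<phi> = nu f \<psi>0 \<psi>0s *\<^sub>C \<psi>0 + f \<psi>0"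
    and C_pos: "C > 0"
    and C_bound: "\<And>\<eta>. \<eta> \<in> Q0 \<psi>0 \<psi>0s ` dom (op_pow A (n - 1))
          \<Longrightarrow> graph_norm A n (reduced_inverse A \<mu>0 \<psi>0 \<psi>0s \<eta>) \<le> C * graph_norm A (n - 1) \<eta>"
    and r2_pos: "r2 > 0"
    and \<epsilon>0_pos: "\<epsilon>0 > 0"
    and unique_correction: "\<And>\<epsilon>. \<lbrakk>0 < \<bar>\<epsilon>\<bar>; \<bar>\<epsilon>\<bar> < \<epsilon>0\<rbrakk>
          \<Longrightarrow> \<exists>!p. is_correction A f Y normY \<mu>0 \<psi>0 \<psi>0s \<phi> r1 r2 \<epsilon> p"
begin

text \<open>The default 0 at \<epsilon> = 0 satisfies the bound and the equation of the correction,
  so the estimates below include the base point.\<close>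

definition chi :: "real \<Rightarrow> 'h" where
  "chi \<epsilon> = (if \<epsilon> = 0 then 0 else snd (correction A f Y normY \<mu>0 \<psi>0 \<psi>0s \<phi> r1 r2 \<epsilon>))"

definition pert :: "real \<Rightarrow> 'h" where
  "pert \<epsilon> = chi \<epsilon> + \<epsilon> *\<^sub>R \<phi>"

definition psi :: "real \<Rightarrow> 'h" where
  "psi \<epsilon> = \<psi>0 + pert \<epsilon>"

text \<open>The term \<open>\<epsilon>\<sigma>\<close>, eliminated by means of the scalar equation. It inherits a Lipschitz bound
  from \<open>f\<close>, which the division by \<open>\<epsilon>\<close> would destroy for \<open>\<sigma>\<close> itself.\<close>

definition shift :: "real \<Rightarrow> complex" where
  "shift \<epsilon> = - cinner (f (psi \<epsilon>) - f \<psi>0) \<psi>0s"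

text \<open>The bracket in the second equation of the system with \<epsilon>\<sigma> eliminated. The
  factor \<epsilon> stays outside because it supplies the smallness.\<close>

definition rhs :: "real \<Rightarrow> 'h" where
  "rhs \<epsilon> = (nu f \<psi>0 \<psi>0s + shift \<epsilon>) *\<^sub>C pert \<epsilon> + Q0 \<psi>0 \<psi>0s (f (psi \<epsilon>) - f \<psi>0)"

lemma zero_simps [simp]: "chi 0 = 0" "pert 0 = 0" "psi 0 = \<psi>0"
  by (simp_all add: chi_def pert_def psi_def)

lemma Q0_zero [simp]: "Q0 \<psi>0 \<psi>0s 0 = 0"
  by (simp add: Q0_def P0_def)

lemma rhs_zero [simp]: "rhs 0 = 0"
  by (simp add: rhs_def)

lemma nonlinear_eigenvector_eq_psi: "nonlinear_eigenvector A f Y normY \<mu>0 \<psi>0 \<psi>0s \<phi> r1 r2 \<epsilon> = psi \<epsilon>"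
  by (simp add: nonlinear_eigenvector_def psi_def pert_def chi_def)

lemma is_correction_correction:
  "0 < \<bar>\<epsilon>\<bar> \<Longrightarrow> \<bar>\<epsilon>\<bar> < \<epsilon>0 \<Longrightarrow> is_correction A f Y normY \<mu>0 \<psi>0 \<psi>0s \<phi> r1 r2 \<epsilon>
    (correction A f Y normY \<mu>0 \<psi>0 \<psi>0s \<phi> r1 r2 \<epsilon>)"
  unfolding correction_def by (rule theI'[OF unique_correction])

lemma op_zero: "A \<bullet>\<^sub>o 0 = 0"
  using linear_operator_scaleC[OF linear_A \<psi>0_dom, of 0] by simp

text \<open>At \<epsilon> = 0 this rests on the default value of \<open>chi\<close>, elsewhere on
  existence and uniqueness of the correction. The scalar equation trades \<epsilon>\<sigma> for
  \<open>shift\<close>.\<close>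

lemma correction_facts:
  assumes "\<bar>\<epsilon>\<bar> < \<epsilon>0"
  shows chi_mem: "chi \<epsilon> \<in> Q0 \<psi>0 \<psi>0s ` dom A"
    and chi_Y: "chi \<epsilon> \<in> Y"
    and normY_chi: "normY (chi \<epsilon>) \<le> r2 * \<epsilon>\<^sup>2"
    and reduced_op_chi: "reduced_op A \<mu>0 \<psi>0 \<psi>0s (chi \<epsilon>) = \<epsilon> *\<^sub>R rhs \<epsilon>"
    and nonlinear_eigenvalue_eq: "nonlinear_eigenvalue A f Y normY \<mu>0 \<psi>0 \<psi>0s \<phi> r1 r2 \<epsilon>
      = \<mu>0 + of_real \<epsilon> * (nu f \<psi>0 \<psi>0s + shift \<epsilon>)"
proof -
  have "chi \<epsilon> \<in> Q0 \<psi>0 \<psi>0s ` dom A \<and> chi \<epsilon> \<in> Y \<and> normY (chi \<epsilon>) \<le> r2 * \<epsilon>\<^sup>2 \<and>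
    reduced_op A \<mu>0 \<psi>0 \<psi>0s (chi \<epsilon>) = \<epsilon> *\<^sub>R rhs \<epsilon> \<and>
    nonlinear_eigenvalue A f Y normY \<mu>0 \<psi>0 \<psi>0s \<phi> r1 r2 \<epsilon>
      = \<mu>0 + of_real \<epsilon> * (nu f \<psi>0 \<psi>0s + shift \<epsilon>)"
  proof (cases "\<epsilon> = 0")
    case True
    then show ?thesis
      using complex_vector.subspace_0[OF linear_operator_subspace[OF linear_A]]
        complex_vector.subspace_0[OF banach_Y_subspace] normY_zero
      by (simp add: mem_Q0_dom_iff reduced_op_def op_zero nonlinear_eigenvalue_def)
  next
    case False
    define \<sigma> where "\<sigma> = fst (correction A f Y normY \<mu>0 \<psi>0 \<psi>0s \<phi> r1 r2 \<epsilon>)"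
    have psi: "\<psi>0 + \<epsilon> *\<^sub>R \<phi> + chi \<epsilon> = psi \<epsilon>"
      by (simp add: psi_def pert_def)
    have "is_correction A f Y normY \<mu>0 \<psi>0 \<psi>0s \<phi> r1 r2 \<epsilon> (\<sigma>, chi \<epsilon>)"
      using is_correction_correction[of \<epsilon>] assms False by (simp add: chi_def \<sigma>_def)
    then have corr: "chi \<epsilon> \<in> Q0 \<psi>0 \<psi>0s ` dom A" "chi \<epsilon> \<in> Y" "normY (chi \<epsilon>) \<le> r2 * \<epsilon>\<^sup>2"
      "0 = of_real \<epsilon> * \<sigma> + cinner (f (psi \<epsilon>) - f \<psi>0) \<psi>0s"
      "reduced_op A \<mu>0 \<psi>0 \<psi>0s (chi \<epsilon>) =
        \<epsilon> *\<^sub>R ((nu f \<psi>0 \<psi>0s + of_real \<epsilon> * \<sigma>) *\<^sub>C pert \<epsilon> + Q0 \<psi>0 \<psi>0s (f (psi \<epsilon>) - f \<psi>0))"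
      by (simp_all add: is_correction_def Let_def psi pert_def)
    have \<sigma>: "of_real \<epsilon> * \<sigma> = shift \<epsilon>"
      using corr(4) by (simp add: shift_def eq_neg_iff_add_eq_0)
    have "nonlinear_eigenvalue A f Y normY \<mu>0 \<psi>0 \<psi>0s \<phi> r1 r2 \<epsilon>
        = \<mu>0 + of_real \<epsilon> * nu f \<psi>0 \<psi>0s + of_real \<epsilon> * (of_real \<epsilon> * \<sigma>)"
      using False by (simp add: nonlinear_eigenvalue_def \<sigma>_def power2_eq_square)
    then show ?thesis
      using corr(1-3,5) by (simp add: \<sigma> rhs_def distrib_left)
  qed
  then show "chi \<epsilon> \<in> Q0 \<psi>0 \<psi>0s ` dom A" "chi \<epsilon> \<in> Y" "normY (chi \<epsilon>) \<le> r2 * \<epsilon>\<^sup>2"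
    "reduced_op A \<mu>0 \<psi>0 \<psi>0s (chi \<epsilon>) = \<epsilon> *\<^sub>R rhs \<epsilon>"
    "nonlinear_eigenvalue A f Y normY \<mu>0 \<psi>0 \<psi>0s \<phi> r1 r2 \<epsilon>
      = \<mu>0 + of_real \<epsilon> * (nu f \<psi>0 \<psi>0s + shift \<epsilon>)"
    by blast+
qed

lemma \<phi>_dom: "\<phi> \<in> dom A" "cinner \<phi> \<psi>0s = 0"
  using \<phi>_mem by (simp_all add: mem_Q0_dom_iff)

lemma f_mem: "x \<in> Y \<Longrightarrow> f x \<in> dom (op_pow A (n - 1))"
  using f_range by blast

lemma \<psi>0_Y: "\<psi>0 \<in> Y"
  using \<psi>0_mem Y_lower by blast

text \<open>The right-hand side of the equation for \<open>\<phi>\<close> has order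
  \<open>n - 1\<close>, which lifts \<open>\<phi>\<close> from \<open>dom A\<close> to order
  \<open>n\<close> and thereby into \<open>Y\<close>.\<close>

lemma \<phi>_dom_op_pow: "\<phi> \<in> dom (op_pow A n)"
proof (rule op_sub_scaleC_dom_imp_dom_op_pow[OF \<phi>_dom(1)])
  show "A \<bullet>\<^sub>o \<phi> - \<mu>0 *\<^sub>C \<phi> \<in> dom (op_pow A (n - 1))"
    unfolding \<phi>_eq using \<psi>0_mem dom_op_pow_n
    by (intro complex_vector.subspace_add[OF subspace_dom_op_pow] f_mem \<psi>0_Y
        complex_vector.subspace_scale[OF subspace_dom_op_pow]) blast
qed

lemma \<phi>_Y: "\<phi> \<in> Y"
  using \<phi>_dom_op_pow Y_lower by blast

section \<open>The eigenvector equation at a fixed parameter\<close>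

context
  fixes \<epsilon>
  assumes \<epsilon>: "\<bar>\<epsilon>\<bar> < \<epsilon>0"
begin

lemma chi_dom: "chi \<epsilon> \<in> dom A" "cinner (chi \<epsilon>) \<psi>0s = 0"
  using chi_mem[OF \<epsilon>] by (simp_all add: mem_Q0_dom_iff)

lemma pert_Y: "pert \<epsilon> \<in> Y"
  unfolding pert_def
  by (intro complex_vector.subspace_add[OF banach_Y_subspace] chi_Y \<epsilon>
      subspace_scaleR[OF banach_Y_subspace] \<phi>_Y)

lemma psi_Y: "psi \<epsilon> \<in> Y"
  unfolding psi_def
  by (intro complex_vector.subspace_add[OF banach_Y_subspace] \<psi>0_Y pert_Y)

lemma f_diff_mem: "f (psi \<epsilon>) - f \<psi>0 \<in> dom (op_pow A (n - 1))"
  by (intro complex_vector.subspace_diff[OF subspace_dom_op_pow] f_mem psi_Y \<psi>0_Y)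

lemma cinner_pert: "cinner (pert \<epsilon>) \<psi>0s = 0"
  by (simp add: pert_def cinner_add_left chi_dom(2) cinner_scaleR_left \<phi>_dom(2))

text \<open>Both summands are annihilated by pairing with \<open>\<psi>0s\<close> and have order
  \<open>n - 1\<close>; this is what \<open>C_bound\<close> asks of its argument.\<close>

lemma rhs_mem: "rhs \<epsilon> \<in> Q0 \<psi>0 \<psi>0s ` dom (op_pow A (n - 1))"
proof -
  have "Q0 \<psi>0 \<psi>0s (f (psi \<epsilon>) - f \<psi>0) \<in> dom (op_pow A (n - 1))"
    using f_diff_mem mem_Q0_dom_op_pow_iff by blast
  moreover have "pert \<epsilon> \<in> dom (op_pow A (n - 1))"
    using pert_Y Y_upper by blast
  ultimately show ?thesis
    unfolding mem_Q0_dom_op_pow_iff rhs_def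
    by (intro conjI complex_vector.subspace_add[OF subspace_dom_op_pow]
        complex_vector.subspace_scale[OF subspace_dom_op_pow])
      (simp_all add: cinner_add_left cinner_scaleC_left cinner_pert cinner_Q0[OF \<psi>0_\<psi>0s])
qed

lemma op_chi: "A \<bullet>\<^sub>o chi \<epsilon> - \<mu>0 *\<^sub>C chi \<epsilon> = \<epsilon> *\<^sub>R rhs \<epsilon>"
  using reduced_op_chi[OF \<epsilon>] reduced_op_eq[OF chi_mem[OF \<epsilon>]] by simp

text \<open>The system places \<open>chi\<close> in \<open>dom A\<close> and \<open>Y\<close> only,
  whereas \<open>norm_lower\<close> and \<open>norm_upper\<close> require order \<open>n\<close>;
  the equation supplies it.\<close>

lemma chi_dom_op_pow: "chi \<epsilon> \<in> dom (op_pow A n)"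
proof (rule op_sub_scaleC_dom_imp_dom_op_pow[OF chi_dom(1)])
  show "A \<bullet>\<^sub>o chi \<epsilon> - \<mu>0 *\<^sub>C chi \<epsilon> \<in> dom (op_pow A (n - 1))"
    unfolding op_chi using rhs_mem unfolding mem_Q0_dom_op_pow_iff
    by (intro subspace_scaleR[OF subspace_dom_op_pow]) blast
qed

lemma pert_dom_op_pow: "pert \<epsilon> \<in> dom (op_pow A n)"
  unfolding pert_def
  by (intro complex_vector.subspace_add[OF subspace_dom_op_pow] chi_dom_op_pow
      subspace_scaleR[OF subspace_dom_op_pow] \<phi>_dom_op_pow)

lemma psi_dom: "psi \<epsilon> \<in> dom A"
  using \<psi>0_dom pert_dom_op_pow dom_op_pow_n_dom unfolding psi_def
  by (intro complex_vector.subspace_add[OF linear_operator_subspace[OF linear_A]]) blast+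

text \<open>The perturbation pairs to 0 with \<open>\<psi>0s\<close>, so the normalisation persists
  along the branch. In particular \<open>psi\<close> never vanishes and may be divided by its
  norm.\<close>

lemma cinner_psi: "cinner (psi \<epsilon>) \<psi>0s = 1"
  by (simp add: psi_def cinner_add_left cinner_pert \<psi>0_\<psi>0s)

lemma psi_nonzero: "psi \<epsilon> \<noteq> 0"
  using cinner_psi by auto

lemma op_psi:
  "A \<bullet>\<^sub>o psi \<epsilon> - (\<mu>0 + of_real \<epsilon> * (nu f \<psi>0 \<psi>0s + shift \<epsilon>)) *\<^sub>C psi \<epsilon> = \<epsilon> *\<^sub>R f (psi \<epsilon>)"
proof -
  let ?\<nu> = "nu f \<psi>0 \<psi>0s" and ?s = "shift \<epsilon>"
  have \<phi>': "\<epsilon> *\<^sub>R \<phi> \<in> dom A"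
    by (intro subspace_scaleR[OF linear_operator_subspace[OF linear_A]] \<phi>_dom)
  have "A \<bullet>\<^sub>o psi \<epsilon> = A \<bullet>\<^sub>o \<psi>0 + (A \<bullet>\<^sub>o chi \<epsilon> + \<epsilon> *\<^sub>R (A \<bullet>\<^sub>o \<phi>))"
    using linear_operator_add[OF linear_A \<psi>0_dom, of "pert \<epsilon>"]
      linear_operator_add[OF linear_A chi_dom(1) \<phi>'] pert_dom_op_pow dom_op_pow_n_dom
      linear_operator_scaleC[OF linear_A \<phi>_dom(1), of "of_real \<epsilon>"]
    by (auto simp: psi_def pert_def scaleR_scaleC)
  also have "A \<bullet>\<^sub>o chi \<epsilon> = \<mu>0 *\<^sub>C chi \<epsilon> + \<epsilon> *\<^sub>R rhs \<epsilon>"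
    using op_chi by (simp add: diff_eq_eq add.commute)
  also have "A \<bullet>\<^sub>o \<phi> = \<mu>0 *\<^sub>C \<phi> + (?\<nu> *\<^sub>C \<psi>0 + f \<psi>0)"
    using \<phi>_eq by (simp add: diff_eq_eq add.commute)
  finally have "A \<bullet>\<^sub>o psi \<epsilon> = \<mu>0 *\<^sub>C psi \<epsilon> + \<epsilon> *\<^sub>R (?\<nu> *\<^sub>C \<psi>0 + f \<psi>0 + rhs \<epsilon>)"
    by (simp add: \<psi>0_eigen psi_def pert_def scaleR_scaleC scaleC_scaleC mult.commute
        complex_vector.scale_right_distrib algebra_simps)
  \<comment> \<open>\<open>Q0\<close> contributes \<open>shift \<epsilon>\<close> times
    \<open>\<psi>0\<close>, which joins the \<open>?\<nu>\<close> term to complete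
    \<open>pert \<epsilon>\<close> to \<open>psi \<epsilon>\<close>, and \<open>f \<psi>0\<close>
    cancels.\<close>
  also have "?\<nu> *\<^sub>C \<psi>0 + f \<psi>0 + rhs \<epsilon> = (?\<nu> + ?s) *\<^sub>C psi \<epsilon> + f (psi \<epsilon>)"
  proof -
    have "Q0 \<psi>0 \<psi>0s (f (psi \<epsilon>) - f \<psi>0) = f (psi \<epsilon>) - f \<psi>0 + ?s *\<^sub>C \<psi>0"
      by (simp add: Q0_def P0_def shift_def)
    then show ?thesis
      by (simp add: rhs_def psi_def scaleC_add_left scaleC_add_right)
  qed
  finally show ?thesis
    by (simp add: scaleR_scaleC scaleC_scaleC scaleC_add_left scaleC_add_right distrib_left)
qed

end

section \<open>Normalisation by homogeneity\<close>

lemma solves_normalised: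
  assumes hom: "\<And>a x. a > 0 \<Longrightarrow> x \<in> Y \<Longrightarrow> f (a *\<^sub>R x) = (a powr q) *\<^sub>R f x"
    and \<epsilon>: "\<bar>\<epsilon>\<bar> < \<epsilon>0"
  shows "solves_nonlinear_eigenproblem A f Y (\<epsilon> * norm (psi \<epsilon>) powr (q - 1))
    (\<mu>0 + of_real \<epsilon> * (nu f \<psi>0 \<psi>0s + shift \<epsilon>)) (inverse (norm (psi \<epsilon>)) *\<^sub>R psi \<epsilon>)"
proof -
  define N where "N = norm (psi \<epsilon>)"
  define m where "m = \<mu>0 + of_real \<epsilon> * (nu f \<psi>0 \<psi>0s + shift \<epsilon>)"
  have N: "N > 0"
    using psi_nonzero[OF \<epsilon>] by (simp add: N_def)
  \<comment> \<open>Homogeneity turns division by \<open>N\<close> inside \<open>f\<close> into the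
    factor \<open>inverse N powr q\<close>; the new parameter is chosen so that
    \<open>inverse N\<close> remains, which is common to all terms.\<close>
  have "N powr (q - 1) * inverse N powr q = inverse N"
    unfolding powr_diff inverse_powr using N by (simp add: field_simps)
  then have f: "(\<epsilon> * N powr (q - 1)) *\<^sub>R f (inverse N *\<^sub>R psi \<epsilon>) = inverse N *\<^sub>R (\<epsilon> *\<^sub>R f (psi \<epsilon>))"
    using N hom[of "inverse N" "psi \<epsilon>"] psi_Y[OF \<epsilon>] by (simp add: mult.assoc mult.commute)
  have "A \<bullet>\<^sub>o (inverse N *\<^sub>R psi \<epsilon>) - m *\<^sub>C (inverse N *\<^sub>R psi \<epsilon>)
      = inverse N *\<^sub>R (A \<bullet>\<^sub>o psi \<epsilon> - m *\<^sub>C psi \<epsilon>)"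
    unfolding scaleR_scaleC linear_operator_scaleC[OF linear_A psi_dom[OF \<epsilon>]]
    by (simp add: complex_vector.scale_right_diff_distrib scaleC_scaleC mult.commute)
  also have "\<dots> = inverse N *\<^sub>R (\<epsilon> *\<^sub>R f (psi \<epsilon>))"
    using op_psi[OF \<epsilon>] by (simp add: m_def)
  finally have "A \<bullet>\<^sub>o (inverse N *\<^sub>R psi \<epsilon>) - m *\<^sub>C (inverse N *\<^sub>R psi \<epsilon>)
      - (\<epsilon> * N powr (q - 1)) *\<^sub>R f (inverse N *\<^sub>R psi \<epsilon>) = 0"
    unfolding f by simp
  moreover have "inverse N *\<^sub>R psi \<epsilon> \<in> dom A \<inter> Y"
    using subspace_scaleR[OF linear_operator_subspace[OF linear_A] psi_dom[OF \<epsilon>]]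
      subspace_scaleR[OF banach_Y_subspace psi_Y[OF \<epsilon>]] by blast
  ultimately show ?thesis
    by (simp add: solves_nonlinear_eigenproblem_def N_def m_def)
qed

section \<open>Lipschitz dependence on the parameter\<close>

lemma normY_chi_diff_le:
  assumes \<epsilon>: "\<bar>\<epsilon>\<bar> < \<epsilon>0" and \<delta>: "\<bar>\<delta>\<bar> < \<epsilon>0"
  shows "k1 * normY (chi \<epsilon> - chi \<delta>) \<le> k2 * C * graph_norm A (n - 1) (\<epsilon> *\<^sub>R rhs \<epsilon> - \<delta> *\<^sub>R rhs \<delta>)"
proof -
  let ?x = "chi \<epsilon> - chi \<delta>" and ?\<eta> = "\<epsilon> *\<^sub>R rhs \<epsilon> - \<delta> *\<^sub>R rhs \<delta>"
  have x: "?x \<in> dom (op_pow A n)"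
    by (intro complex_vector.subspace_diff[OF subspace_dom_op_pow] chi_dom_op_pow \<epsilon> \<delta>)
  have xQ: "?x \<in> Q0 \<psi>0 \<psi>0s ` dom A"
    using x dom_op_pow_n_dom chi_dom(2)[OF \<epsilon>] chi_dom(2)[OF \<delta>]
    by (auto simp: mem_Q0_dom_iff cinner_diff_left)
  have \<eta>: "?\<eta> \<in> Q0 \<psi>0 \<psi>0s ` dom (op_pow A (n - 1))"
    using rhs_mem[OF \<epsilon>] rhs_mem[OF \<delta>] unfolding mem_Q0_dom_op_pow_iff
    by (intro conjI complex_vector.subspace_diff[OF subspace_dom_op_pow]
        subspace_scaleR[OF subspace_dom_op_pow])
      (simp_all add: cinner_diff_left cinner_scaleR_left)
  \<comment> \<open>By linearity the difference solves the equation with the difference of the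
    right-hand sides, and injectivity identifies it with the value of \<open>reduced_inverse\<close>
    there. \<open>C_bound\<close> then gains the order that \<open>norm_upper\<close> needs.\<close>
  have "reduced_op A \<mu>0 \<psi>0 \<psi>0s ?x = ?\<eta>"
    unfolding reduced_op_eq[OF xQ] linear_operator_diff[OF linear_A chi_dom(1)[OF \<epsilon>] chi_dom(1)[OF \<delta>]]
      op_chi[OF \<epsilon>, symmetric] op_chi[OF \<delta>, symmetric]
    by (simp add: complex_vector.scale_right_diff_distrib)
  then have "reduced_inverse A \<mu>0 \<psi>0 \<psi>0s ?\<eta> = ?x"
    using inv_into_f_f[OF inj_on_reduced_op xQ] by (simp add: reduced_inverse_def)
  then have "graph_norm A n ?x \<le> C * graph_norm A (n - 1) ?\<eta>"
    using C_bound[OF \<eta>] by simp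
  then have "k2 * graph_norm A n ?x \<le> k2 * (C * graph_norm A (n - 1) ?\<eta>)"
    using k2_pos by (intro mult_left_mono) auto
  then show ?thesis
    using norm_upper[OF x] by (simp add: mult.assoc)
qed

text \<open>A bound linear in \<epsilon> suffices to stay inside the ball where \<open>f\<close> is
  Lipschitz; the quadratic bound on \<open>chi\<close> is weakened to it.\<close>

lemma normY_pert_le:
  assumes "\<bar>\<epsilon>\<bar> < \<epsilon>0" "\<bar>\<epsilon>\<bar> \<le> 1"
  shows "normY (pert \<epsilon>) \<le> \<bar>\<epsilon>\<bar> * (r2 + normY \<phi>)"
proof -
  have "normY (pert \<epsilon>) \<le> normY (chi \<epsilon>) + normY (\<epsilon> *\<^sub>R \<phi>)"
    unfolding pert_def
    by (intro normY_add chi_Y assms subspace_scaleR[OF banach_Y_subspace] \<phi>_Y)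
  also have "normY (\<epsilon> *\<^sub>R \<phi>) = \<bar>\<epsilon>\<bar> * normY \<phi>"
    by (simp add: scaleR_scaleC normY_scaleC \<phi>_Y)
  also have "normY (chi \<epsilon>) \<le> r2 * \<epsilon>\<^sup>2"
    by (rule normY_chi[OF assms(1)])
  also have "\<epsilon>\<^sup>2 \<le> \<bar>\<epsilon>\<bar>"
    using assms(2) by (metis abs_ge_zero mult_left_le power2_abs power2_eq_square)
  finally show ?thesis
    using r2_pos by (simp add: algebra_simps)
qed

lemma graph_norm_f_diff_le:
  assumes \<epsilon>: "\<bar>\<epsilon>\<bar> < \<epsilon>0" "normY (pert \<epsilon>) < rL" and \<delta>: "\<bar>\<delta>\<bar> < \<epsilon>0" "normY (pert \<delta>) < rL"
  shows "graph_norm A (n - 1) (f (psi \<epsilon>) - f (psi \<delta>)) \<le> k1 * L * normY (pert \<epsilon> - pert \<delta>)"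
  using f_lipschitz[OF psi_Y[OF \<epsilon>(1)] psi_Y[OF \<delta>(1)]] \<epsilon>(2) \<delta>(2) by (simp add: psi_def)

lemma cmod_shift_diff_le:
  assumes \<epsilon>: "\<bar>\<epsilon>\<bar> < \<epsilon>0" "normY (pert \<epsilon>) < rL" and \<delta>: "\<bar>\<delta>\<bar> < \<epsilon>0" "normY (pert \<delta>) < rL"
  shows "cmod (shift \<epsilon> - shift \<delta>) \<le> k1 * L * norm \<psi>0s * normY (pert \<epsilon> - pert \<delta>)"
proof -
  have "shift \<epsilon> - shift \<delta> = - cinner (f (psi \<epsilon>) - f (psi \<delta>)) \<psi>0s"
    by (simp add: shift_def cinner_diff_left)
  then have "cmod (shift \<epsilon> - shift \<delta>) \<le> graph_norm A (n - 1) (f (psi \<epsilon>) - f (psi \<delta>)) * norm \<psi>0s"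
    by (simp add: norm_cinner_\<psi>0s_le)
  also have "\<dots> \<le> (k1 * L * normY (pert \<epsilon> - pert \<delta>)) * norm \<psi>0s"
    by (intro mult_right_mono graph_norm_f_diff_le assms) simp
  finally show ?thesis
    by (simp add: algebra_simps)
qed

text \<open>\<open>rhs\<close> is a product of bounded Lipschitz factors plus a Lipschitz term. The
  modulus is measured in \<open>pert\<close>, which still contains the unknown difference of the
  corrections.\<close>

lemma graph_norm_rhs_diff_le:
  obtains M where "M \<ge> 0"
    "\<And>\<epsilon> \<delta>. \<lbrakk>\<bar>\<epsilon>\<bar> < \<epsilon>0; normY (pert \<epsilon>) < rL; \<bar>\<delta>\<bar> < \<epsilon>0; normY (pert \<delta>) < rL\<rbrakk>
      \<Longrightarrow> graph_norm A (n - 1) (rhs \<epsilon> - rhs \<delta>) \<le> M * normY (pert \<epsilon> - pert \<delta>)"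
proof -
  let ?N = "graph_norm A (n - 1)" and ?\<nu> = "nu f \<psi>0 \<psi>0s" and ?s = "k1 * L * norm \<psi>0s"
  define KQ where "KQ = 1 + norm \<psi>0s * ?N \<psi>0"
  \<comment> \<open>The three summands come from \<open>?a\<close>, \<open>?b\<close> and
    \<open>?c\<close> below, the pieces of the difference of \<open>rhs\<close>.\<close>
  define M where "M = (cmod ?\<nu> + ?s * rL) * k1 + ?s * (k1 * rL) + KQ * (k1 * L)"
  have s: "?s \<ge> 0" and KQ: "KQ \<ge> 0"
    using k1_pos L_pos by (simp_all add: KQ_def graph_norm_nonneg)
  have "M \<ge> 0"
    using s KQ k1_pos L_pos rL_pos by (simp add: M_def)
  moreover have "?N (rhs \<epsilon> - rhs \<delta>) \<le> M * normY (pert \<epsilon> - pert \<delta>)"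
    if \<epsilon>: "\<bar>\<epsilon>\<bar> < \<epsilon>0" "normY (pert \<epsilon>) < rL" and \<delta>: "\<bar>\<delta>\<bar> < \<epsilon>0" "normY (pert \<delta>) < rL" for \<epsilon> \<delta>
  proof -
    define d where "d = normY (pert \<epsilon> - pert \<delta>)"
    have pd: "pert \<epsilon> - pert \<delta> \<in> dom (op_pow A n)"
      by (intro complex_vector.subspace_diff[OF subspace_dom_op_pow] pert_dom_op_pow \<epsilon> \<delta>)
    then have d0: "d \<ge> 0"
      unfolding d_def using Y_lower by (intro normY_nonneg) blast
    let ?a = "(?\<nu> + shift \<epsilon>) *\<^sub>C (pert \<epsilon> - pert \<delta>)" and ?b = "(shift \<epsilon> - shift \<delta>) *\<^sub>C pert \<delta>"
      and ?c = "Q0 \<psi>0 \<psi>0s (f (psi \<epsilon>) - f (psi \<delta>))"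
    have mem: "pert \<epsilon> - pert \<delta> \<in> dom (op_pow A (n - 1))" "pert \<delta> \<in> dom (op_pow A (n - 1))"
      "f (psi \<epsilon>) - f (psi \<delta>) \<in> dom (op_pow A (n - 1))"
      using pd pert_dom_op_pow[OF \<delta>(1)] dom_op_pow_n
        complex_vector.subspace_diff[OF subspace_dom_op_pow f_mem[OF psi_Y[OF \<epsilon>(1)]] f_mem[OF psi_Y[OF \<delta>(1)]]]
      by blast+
    have ab: "?a \<in> dom (op_pow A (n - 1))" "?b \<in> dom (op_pow A (n - 1))"
      by (intro complex_vector.subspace_scale[OF subspace_dom_op_pow] mem)+
    have c: "?c \<in> dom (op_pow A (n - 1))"
      using mem(3) mem_Q0_dom_op_pow_iff by blast
    have "rhs \<epsilon> - rhs \<delta> = (?a + ?b) + ?c"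
      by (simp add: rhs_def Q0_diff complex_vector.scale_right_diff_distrib
          complex_vector.scale_left_diff_distrib scaleC_add_left)
    then have "?N (rhs \<epsilon> - rhs \<delta>) \<le> ?N ?a + ?N ?b + ?N ?c"
      using graph_norm_add[OF linear_A complex_vector.subspace_add[OF subspace_dom_op_pow ab] c]
        graph_norm_add[OF linear_A ab] by simp
    also have "?N ?a \<le> (cmod ?\<nu> + ?s * rL) * (k1 * d)"
    proof -
      \<comment> \<open>Since \<open>shift 0\<close> vanishes, comparing with the parameter 0 turns
        the Lipschitz bound into a bound on \<open>shift\<close> itself.\<close>
      have "cmod (shift \<epsilon> - shift 0) \<le> ?s * normY (pert \<epsilon> - pert 0)"
        using \<epsilon> \<epsilon>0_pos rL_pos normY_zero by (intro cmod_shift_diff_le) auto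
      also have "\<dots> \<le> ?s * rL"
        using \<epsilon>(2) s by (intro mult_left_mono) auto
      finally have "cmod (shift \<epsilon>) \<le> ?s * rL"
        by (simp add: shift_def)
      then have "cmod (?\<nu> + shift \<epsilon>) \<le> cmod ?\<nu> + ?s * rL"
        by (intro order_trans[OF norm_triangle_ineq]) simp
      then show ?thesis
        unfolding graph_norm_scaleC[OF linear_A mem(1)] d_def
        using s rL_pos by (intro mult_mono norm_lower pd) (auto simp: graph_norm_nonneg)
    qed
    also have "?N ?b \<le> (?s * d) * (k1 * rL)"
    proof -
      have "?N (pert \<delta>) \<le> k1 * normY (pert \<delta>)"
        by (intro norm_lower pert_dom_op_pow \<delta>)
      also have "\<dots> \<le> k1 * rL"
        using \<delta>(2) k1_pos by simp
      finally show ?thesis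
        unfolding graph_norm_scaleC[OF linear_A mem(2)]
        using s d0 cmod_shift_diff_le[OF \<epsilon> \<delta>]
        by (intro mult_mono) (auto simp: graph_norm_nonneg d_def)
    qed
    also have "?N ?c \<le> KQ * (k1 * L * d)"
      unfolding KQ_def d_def
      by (rule order_trans[OF graph_norm_Q0[OF mem(3)]])
        (intro mult_left_mono graph_norm_f_diff_le \<epsilon> \<delta>, simp add: graph_norm_nonneg)
    finally show ?thesis
      by (simp add: M_def d_def algebra_simps)
  qed
  ultimately show ?thesis
    by (rule that)
qed

lemma psi_lipschitz:
  obtains e K where "0 < e" "e \<le> \<epsilon>0" "K-lipschitz_on (ball 0 e) psi"
proof -
  let ?N = "graph_norm A (n - 1)"
  obtain M where M: "M \<ge> 0"
    "\<And>\<epsilon> \<delta>. \<lbrakk>\<bar>\<epsilon>\<bar> < \<epsilon>0; normY (pert \<epsilon>) < rL; \<bar>\<delta>\<bar> < \<epsilon>0; normY (pert \<delta>) < rL\<rbrakk>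
      \<Longrightarrow> ?N (rhs \<epsilon> - rhs \<delta>) \<le> M * normY (pert \<epsilon> - pert \<delta>)"
    using graph_norm_rhs_diff_le by blast
  define R where "R = r2 + normY \<phi>"
  \<comment> \<open>\<open>B\<close> collects the factors from inverting and from changing norms. In
    \<open>K\<close>, the factor 2 comes from absorbing half of \<open>d\<close>, and
    \<open>k1\<close> from returning to the Hilbert space norm.\<close>
  define B where "B = k2 * C * M / k1"
  define K where "K = k1 * (2 * B * rL + 2 * normY \<phi>)"
  have \<phi>0: "normY \<phi> \<ge> 0"
    by (rule normY_nonneg[OF \<phi>_Y])
  then have R: "R > 0"
    using r2_pos by (simp add: R_def)
  have B: "B \<ge> 0"
    using M(1) k1_pos k2_pos C_pos by (simp add: B_def)
  have K: "K \<ge> 0"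
    using B \<phi>0 k1_pos rL_pos by (simp add: K_def)
  \<comment> \<open>In order: the branch exists, the square of \<epsilon> is at most its modulus,
    \<open>pert\<close> stays below \<open>rL\<close>, and \<open>B * |\<epsilon>|\<close> is at
    most 1/2.\<close>
  define e where "e = min (min \<epsilon>0 1) (min (rL / R) (1 / (2 * (B + 1))))"
  have "e > 0"
    using \<epsilon>0_pos rL_pos R B by (simp add: e_def)
  have "e \<le> \<epsilon>0"
    by (simp add: e_def)
  have small: "\<bar>\<epsilon>\<bar> < \<epsilon>0" "normY (pert \<epsilon>) < rL" "B * \<bar>\<epsilon>\<bar> \<le> 1 / 2" if "\<bar>\<epsilon>\<bar> < e" for \<epsilon>
  proof -
    have \<epsilon>: "\<bar>\<epsilon>\<bar> < \<epsilon>0" "\<bar>\<epsilon>\<bar> \<le> 1" "\<bar>\<epsilon>\<bar> < rL / R" "\<bar>\<epsilon>\<bar> < 1 / (2 * (B + 1))"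
      using that by (auto simp: e_def)
    show "\<bar>\<epsilon>\<bar> < \<epsilon>0"
      by (rule \<epsilon>)
    have "\<bar>\<epsilon>\<bar> * R < rL"
      using \<epsilon>(3) R by (simp add: pos_less_divide_eq)
    then show "normY (pert \<epsilon>) < rL"
      using normY_pert_le[OF \<epsilon>(1,2)] by (simp add: R_def)
    have "\<bar>\<epsilon>\<bar> * (2 * (B + 1)) < 1"
      using \<epsilon>(4) B by (simp add: pos_less_divide_eq)
    then show "B * \<bar>\<epsilon>\<bar> \<le> 1 / 2"
      by (simp add: algebra_simps)
  qed
  have "K-lipschitz_on (ball 0 e) psi"
  proof (rule lipschitz_onI)
    fix \<epsilon> \<delta> :: real assume "\<epsilon> \<in> ball 0 e" "\<delta> \<in> ball 0 e"
    then have "\<bar>\<epsilon>\<bar> < e" "\<bar>\<delta>\<bar> < e"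
      by auto
    note \<epsilon> = small[OF this(1)] and \<delta> = small[OF this(2)]
    define X where "X = normY (chi \<epsilon> - chi \<delta>)"
    define d where "d = normY (pert \<epsilon> - pert \<delta>)"
    have mem: "rhs \<epsilon> \<in> dom (op_pow A (n - 1))" "rhs \<delta> \<in> dom (op_pow A (n - 1))"
      using rhs_mem[OF \<epsilon>(1)] rhs_mem[OF \<delta>(1)] unfolding mem_Q0_dom_op_pow_iff by blast+
    have Y: "chi \<epsilon> - chi \<delta> \<in> Y" "(\<epsilon> - \<delta>) *\<^sub>R \<phi> \<in> Y"
      by (intro complex_vector.subspace_diff[OF banach_Y_subspace] chi_Y \<epsilon> \<delta>
          subspace_scaleR[OF banach_Y_subspace] \<phi>_Y)+
    have pert_diff: "pert \<epsilon> - pert \<delta> = (chi \<epsilon> - chi \<delta>) + (\<epsilon> - \<delta>) *\<^sub>R \<phi>"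
      by (simp add: pert_def algebra_simps)
    then have d: "d \<le> X + \<bar>\<epsilon> - \<delta>\<bar> * normY \<phi>"
      using normY_add[OF Y] normY_scaleC[OF \<phi>_Y, of "of_real (\<epsilon> - \<delta>)"]
      by (simp add: d_def X_def scaleR_scaleC flip: of_real_diff)
    have rhs_\<epsilon>: "?N (rhs \<epsilon>) \<le> M * rL"
    proof -
      have "?N (rhs \<epsilon> - rhs 0) \<le> M * normY (pert \<epsilon> - pert 0)"
        using \<epsilon> \<epsilon>0_pos rL_pos normY_zero by (intro M(2)) auto
      also have "\<dots> \<le> M * rL"
        using \<epsilon>(2) M(1) by (intro mult_left_mono) auto
      finally show ?thesis
        by simp
    qed
    have diff_mem: "rhs \<epsilon> - rhs \<delta> \<in> dom (op_pow A (n - 1))"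
      by (intro complex_vector.subspace_diff[OF subspace_dom_op_pow] mem)
    \<comment> \<open>The difference of the parameters is split off so that the unknown difference
      of \<open>rhs\<close> keeps the small factor \<delta>.\<close>
    have "\<epsilon> *\<^sub>R rhs \<epsilon> - \<delta> *\<^sub>R rhs \<delta>
        = of_real (\<epsilon> - \<delta>) *\<^sub>C rhs \<epsilon> + of_real \<delta> *\<^sub>C (rhs \<epsilon> - rhs \<delta>)"
      by (simp add: algebra_simps flip: scaleR_scaleC)
    then have "?N (\<epsilon> *\<^sub>R rhs \<epsilon> - \<delta> *\<^sub>R rhs \<delta>)
        \<le> ?N (of_real (\<epsilon> - \<delta>) *\<^sub>C rhs \<epsilon>) + ?N (of_real \<delta> *\<^sub>C (rhs \<epsilon> - rhs \<delta>))"
      using graph_norm_add[OF linear_A]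
        complex_vector.subspace_scale[OF subspace_dom_op_pow mem(1)]
        complex_vector.subspace_scale[OF subspace_dom_op_pow diff_mem] by metis
    also have "\<dots> = \<bar>\<epsilon> - \<delta>\<bar> * ?N (rhs \<epsilon>) + \<bar>\<delta>\<bar> * ?N (rhs \<epsilon> - rhs \<delta>)"
      unfolding graph_norm_scaleC[OF linear_A mem(1)] graph_norm_scaleC[OF linear_A diff_mem]
      by (simp only: norm_of_real)
    also have "\<dots> \<le> \<bar>\<epsilon> - \<delta>\<bar> * (M * rL) + \<bar>\<delta>\<bar> * (M * d)"
      using M(2)[OF \<epsilon>(1,2) \<delta>(1,2)] rhs_\<epsilon> by (intro add_mono mult_left_mono) (auto simp: d_def)
    finally have "k2 * C * ?N (\<epsilon> *\<^sub>R rhs \<epsilon> - \<delta> *\<^sub>R rhs \<delta>)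
        \<le> k2 * C * (\<bar>\<epsilon> - \<delta>\<bar> * (M * rL) + \<bar>\<delta>\<bar> * (M * d))"
      using k2_pos C_pos by (intro mult_left_mono) auto
    then have "k1 * X \<le> k2 * C * (\<bar>\<epsilon> - \<delta>\<bar> * (M * rL) + \<bar>\<delta>\<bar> * (M * d))"
      using normY_chi_diff_le[OF \<epsilon>(1) \<delta>(1)] by (simp add: X_def)
    also have "\<dots> = k1 * (B * rL * \<bar>\<epsilon> - \<delta>\<bar> + B * \<bar>\<delta>\<bar> * d)"
      using k1_pos by (simp add: B_def field_simps)
    finally have "X \<le> B * rL * \<bar>\<epsilon> - \<delta>\<bar> + B * \<bar>\<delta>\<bar> * d"
      using k1_pos by simp
    \<comment> \<open>Smallness of \<open>B * |\<delta>|\<close> leaves half of \<open>d\<close>,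
      which moves to the left once this is inserted into the bound of \<open>d\<close> by
      \<open>X\<close>.\<close>
    also have "\<dots> \<le> B * rL * \<bar>\<epsilon> - \<delta>\<bar> + 1 / 2 * d"
    proof -
      have "d \<ge> 0"
        unfolding d_def pert_diff
        by (intro normY_nonneg complex_vector.subspace_add[OF banach_Y_subspace] Y)
      then show ?thesis
        using \<delta>(3) by (intro add_left_mono mult_right_mono) auto
    qed
    finally have dK: "d \<le> (2 * B * rL + 2 * normY \<phi>) * \<bar>\<epsilon> - \<delta>\<bar>"
      using d by (simp add: algebra_simps)
    have "norm (pert \<epsilon> - pert \<delta>) \<le> ?N (pert \<epsilon> - pert \<delta>)"
      by (rule norm_le_graph_norm)
    also have "\<dots> \<le> k1 * d"
      unfolding d_def
      by (intro norm_lower complex_vector.subspace_diff[OF subspace_dom_op_pow] pert_dom_op_pow \<epsilon> \<delta>)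
    also have "\<dots> \<le> k1 * ((2 * B * rL + 2 * normY \<phi>) * \<bar>\<epsilon> - \<delta>\<bar>)"
      using dK k1_pos by (intro mult_left_mono) auto
    finally show "dist (psi \<epsilon>) (psi \<delta>) \<le> K * dist \<epsilon> \<delta>"
      by (simp add: dist_norm psi_def K_def mult.assoc)
  qed (rule K)
  with \<open>e > 0\<close> \<open>e \<le> \<epsilon>0\<close> show ?thesis
    by (rule that)
qed

end

theorem corollary3p2:
  fixes A :: "'h::complex_hilbert \<rightharpoonup> 'h"
    and f :: "'h \<Rightarrow> 'h" and Y :: "'h set" and normY :: "'h \<Rightarrow> real" and n :: nat
    and \<mu>0 :: complex and \<psi>0 \<psi>0s \<phi> :: 'h
    and k1 k2 rL L C r1 r2 \<epsilon>0 q :: real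
    and \<mu> :: "real \<Rightarrow> complex" and \<psi> :: "real \<Rightarrow> 'h"
  assumes basic: "basic_assumption A f Y normY n \<mu>0 \<psi>0 \<psi>0s k1 k2 rL L"
    and homogeneous: "\<And>a x. \<lbrakk>a > 0; x \<in> Y\<rbrakk> \<Longrightarrow> f (a *\<^sub>R x) = (a powr q) *\<^sub>R f x"
    and \<phi>_mem: "\<phi> \<in> Q0 \<psi>0 \<psi>0s ` dom A"
    and \<phi>_eq: "A \<bullet>\<^sub>o \<phi> - \<mu>0 *\<^sub>C \<phi> = nu f \<psi>0 \<psi>0s *\<^sub>C \<psi>0 + f \<psi>0"
    and C_pos: "C > 0"
    and C_bound: "\<And>\<eta>. \<eta> \<in> Q0 \<psi>0 \<psi>0s ` dom (op_pow A (n - 1))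
          \<Longrightarrow> graph_norm A n (reduced_inverse A \<mu>0 \<psi>0 \<psi>0s \<eta>) \<le> C * graph_norm A (n - 1) \<eta>"
    and r1: "r1 > 0" "r1 > k1 * L * onorm (P0 \<psi>0 \<psi>0s) * normY \<phi>"
    and r2: "r2 > 0"
      "r2 > k2 * C * (cmod (nu f \<psi>0 \<psi>0s) + onorm (Q0 \<psi>0 \<psi>0s) * L) * normY \<phi>"
    and \<epsilon>0_pos: "\<epsilon>0 > 0"
    and unique_correction: "\<And>\<epsilon>. \<lbrakk>0 < \<bar>\<epsilon>\<bar>; \<bar>\<epsilon>\<bar> < \<epsilon>0\<rbrakk>
          \<Longrightarrow> \<exists>!p. is_correction A f Y normY \<mu>0 \<psi>0 \<psi>0s \<phi> r1 r2 \<epsilon> p"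
    and \<mu>_eq: "\<mu> = nonlinear_eigenvalue A f Y normY \<mu>0 \<psi>0 \<psi>0s \<phi> r1 r2"
    and \<psi>_eq: "\<psi> = nonlinear_eigenvector A f Y normY \<mu>0 \<psi>0 \<psi>0s \<phi> r1 r2"
  shows "(\<forall>\<epsilon>. \<bar>\<epsilon>\<bar> < \<epsilon>0 \<longrightarrow>
            (let \<epsilon>t = \<epsilon> * norm (\<psi> \<epsilon>) powr (q - 1);
                 \<mu>t = \<mu> \<epsilon>;
                 \<psi>t = inverse (norm (\<psi> \<epsilon>)) *\<^sub>R \<psi> \<epsilon>
             in solves_nonlinear_eigenproblem A f Y \<epsilon>t \<mu>t \<psi>t \<and> norm \<psi>t = 1)) \<and>
         (\<exists>\<epsilon>1. 0 < \<epsilon>1 \<and> \<epsilon>1 \<le> \<epsilon>0 \<and>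
            inj_on (\<lambda>\<epsilon>. \<epsilon> * norm (\<psi> \<epsilon>) powr (q - 1)) {\<epsilon>. \<bar>\<epsilon>\<bar> < \<epsilon>1})"
proof -
  interpret nonlinear_branch A f Y normY n \<mu>0 \<psi>0 \<psi>0s k1 k2 rL L \<phi> C r1 r2 \<epsilon>0
    by (intro nonlinear_branch.intro nonlinear_branch_axioms.intro)
      (fact basic \<phi>_mem \<phi>_eq C_pos C_bound r2 \<epsilon>0_pos unique_correction)+
  have \<psi>: "\<psi> = psi"
    by (simp add: fun_eq_iff \<psi>_eq nonlinear_eigenvector_eq_psi)
  obtain e K where e: "0 < e" "e \<le> \<epsilon>0" "K-lipschitz_on (ball 0 e) psi"
    by (rule psi_lipschitz)
  \<comment> \<open>The exponent is \<open>q - 1\<close>, and the norm 1 at the base point is that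
    of \<open>\<psi>0\<close>.\<close>
  obtain d where d: "0 < d" "d \<le> e" "inj_on (\<lambda>\<epsilon>. \<epsilon> * norm (psi \<epsilon>) powr (q - 1)) (ball 0 d)"
    using inj_on_mult_norm_powr[OF e(1,3)] \<psi>0_norm zero_simps(3) by metis
  have "ball 0 d = {\<epsilon>. \<bar>\<epsilon>\<bar> < d}"
    by auto
  then have "\<exists>\<epsilon>1>0. \<epsilon>1 \<le> \<epsilon>0 \<and> inj_on (\<lambda>\<epsilon>. \<epsilon> * norm (psi \<epsilon>) powr (q - 1)) {\<epsilon>. \<bar>\<epsilon>\<bar> < \<epsilon>1}"
    using d e(2) by (intro exI[of _ d]) auto
  then show ?thesis
    using solves_normalised[OF homogeneous] psi_nonzero nonlinear_eigenvalue_eq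
    by (simp add: Let_def \<psi> \<mu>_eq)
qed

end
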